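(* Consider the Hamiltonian functional $$h(k_1,k_2)=\frac12\int_{S^1}(k_1^2+k_2^2)\,dx,$$ so that $\frac{\delta h}{\delta k_1}=k_1$ and $\frac{\delta h}{\delta k_2}=k_2$. Then the star-shaped flow of curves in the upper light cone given by $$\mathbf u_t=\begin{pmatrix}A^{-1}-\hat u\,\xi^T&\hat u\\ -u_3\,\xi^T&u_3\end{pmatrix}\begin{pmatrix}k_1\\ k_2\\ -k_1'\end{pmatrix}$$ preserves arc-length parametrization (if $\|u'\|_J=1$ at the initial time then $\|u'\|_J=1$ for all times) and, if the initial condition is parametrized by arc-length, it induces on the invariants $k_1,k_2$ the complexly coupled system of KdV equations $$(k_1)_t=-k_1'''+3k_1k_1'+3k_2k_2',\qquad (k_2)_t=k_2'''+k_1'k_2-k_1k_2'.$$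
   Context: Set $$J=\begin{pmatrix}0&0&0&-1\\ 0&1&0&0\\ 0&0&1&0\\ -1&0&0&0\end{pmatrix},$$ $\langle u,v\rangle_J=u^TJv$, $\|u\|_J^2=\langle u,u\rangle_J$ on $\mathbb{R}^4$ with coordinates $(u_0,u_1,u_2,u_3)$; the light cone is $C_L=\{u:\langle u,u\rangle_J=0\}$. On the upper cone with $u_3>0$, $u_0=\|\hat u\|^2/(2u_3)$ with $\hat u=(u_1,u_2)^T$, and $\mathbf u=\begin{pmatrix}\hat u\\ u_3\end{pmatrix}$ are local coordinates. Prime denotes $d/dx$. Curves are star-shaped (non-radial): $\|u'\|_J\neq0$; arc-length parametrized means $\|u'\|_J=1$. Curves are assumed to have monodromy in $O(3,1)=\{\Theta:\Theta^TJ\Theta=J\}$, so that the invariants are periodic in $x\in S^1$. For vectors $a,b,c\in\mathbb{R}^4$, $\det(a,b,c)$ is the $3\times3$ determinant with rows $(a_1,a_2,a_3),(b_1,b_2,b_3),(c_1,c_2,c_3)$. Define $$A=\frac{1}{u_3\|u'\|_J}\begin{pmatrix}u_3u_1'-u_1u_3'&u_3u_2'-u_2u_3'\\ u_2u_3'-u_3u_2'&u_3u_1'-u_1u_3'\end{pmatrix},\quad \xi=\begin{pmatrix}\xi_1\\ \xi_2\end{pmatrix},\quad \xi_1=-\frac{u_3'}{u_3\|u'\|_J},\quad \xi_2=-\frac{\det(u,u',u'')}{u_3\|u'\|_J^3},$$ and the differential invariants $$k_0=\|u'\|_J,\quad k_1=\frac{\langle u',u''\rangle_J^2-\|u'\|_J^2\|u''\|_J^2}{2\|u'\|_J^5},\quad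 k_2=\frac{\det(u,u',u''')}{u_3\|u'\|_J^3}-\frac{3\langle u',u''\rangle_J\det(u,u',u'')}{u_3\|u'\|_J^5}.$$ "Preserves arc-length" is understood in the sense stated in the claim. *)

theory Defs
  imports "HOL-Analysis.Analysis"
begin

section \<open>The Lorentzian form and the upper light cone\<close>

text \<open>
  Vectors of $\mathbb{R}^4$ are indexed by \<open>0, 1, 2, 3 :: 4\<close>; the type \<open>4\<close> consists of the integers
  modulo 4, so these are four distinct indices and they exhaust the type.
\<close>

definition J :: "real^4^4" where
  "J = (\<chi> i j. if (i = 0 \<and> j = 3) \<or> (i = 3 \<and> j = 0) then - 1
               else if i = j \<and> (i = 1 \<or> i = 2) then 1 else 0)"

definition ipJ :: "real^4 \<Rightarrow> real^4 \<Rightarrow> real" where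
  "ipJ u v = u \<bullet> (J *v v)"

text \<open>
  Vectors tangent to the light cone have \<open>ipJ v v \<ge> 0\<close>, so the root is the usual one wherever
  \<open>normJ\<close> is used below.
\<close>

definition normJ :: "real^4 \<Rightarrow> real" where
  "normJ u = sqrt (ipJ u u)"

definition O31 :: "(real^4^4) set" where
  "O31 = {\<Theta>. transpose \<Theta> ** J ** \<Theta> = J}"

definition light_cone :: "(real^4) set" where
  "light_cone = {u. ipJ u u = 0}"

text \<open>On this set the equation of the cone reads \<open>u $ 0 = ((u $ 1)\<^sup>2 + (u $ 2)\<^sup>2) / (2 * u $ 3)\<close>.\<close>

definition upper_light_cone :: "(real^4) set" where
  "upper_light_cone = {u \<in> light_cone. u $ 3 > 0}"

definition hat :: "real^4 \<Rightarrow> real^2" where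
  "hat u = vector [u $ 1, u $ 2]"

definition loc :: "real^4 \<Rightarrow> real^3" where
  "loc u = vector [u $ 1, u $ 2, u $ 3]"

definition det3 :: "real^4 \<Rightarrow> real^4 \<Rightarrow> real^4 \<Rightarrow> real" where
  "det3 a b c = det (vector [loc a, loc b, loc c] :: real^3^3)"


section \<open>Curves and their differential invariants\<close>

definition dx :: "(real \<Rightarrow> 'a::real_normed_vector) \<Rightarrow> real \<Rightarrow> 'a" where
  "dx \<gamma> = (\<lambda>x. vector_derivative \<gamma> (at x))"

definition star_shaped :: "(real \<Rightarrow> real^4) \<Rightarrow> bool" where
  "star_shaped \<gamma> \<longleftrightarrow> (\<forall>x. normJ (dx \<gamma> x) \<noteq> 0)"

definition arc_length_parametrized :: "(real \<Rightarrow> real^4) \<Rightarrow> bool" where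
  "arc_length_parametrized \<gamma> \<longleftrightarrow> (\<forall>x. normJ (dx \<gamma> x) = 1)"

text \<open>Here $S^1 = \mathbb{R}/L\mathbb{Z}$; a curve is given by its lift to the real line.\<close>

definition has_monodromy :: "real \<Rightarrow> (real \<Rightarrow> real^4) \<Rightarrow> bool" where
  "has_monodromy L \<gamma> \<longleftrightarrow> (\<exists>\<Theta>\<in>O31. \<forall>x. \<gamma> (x + L) = \<Theta> *v \<gamma> x)"

definition k1 :: "(real \<Rightarrow> real^4) \<Rightarrow> real \<Rightarrow> real" where
  "k1 \<gamma> x = ((ipJ (dx \<gamma> x) ((dx ^^ 2) \<gamma> x))\<^sup>2 - (normJ (dx \<gamma> x))\<^sup>2 * ipJ ((dx ^^ 2) \<gamma> x) ((dx ^^ 2) \<gamma> x))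
              / (2 * (normJ (dx \<gamma> x)) ^ 5)"

definition k2 :: "(real \<Rightarrow> real^4) \<Rightarrow> real \<Rightarrow> real" where
  "k2 \<gamma> x = det3 (\<gamma> x) (dx \<gamma> x) ((dx ^^ 3) \<gamma> x) / (\<gamma> x $ 3 * (normJ (dx \<gamma> x)) ^ 3)
          - 3 * ipJ (dx \<gamma> x) ((dx ^^ 2) \<gamma> x) * det3 (\<gamma> x) (dx \<gamma> x) ((dx ^^ 2) \<gamma> x)
              / (\<gamma> x $ 3 * (normJ (dx \<gamma> x)) ^ 5)"

definition frame_A :: "(real \<Rightarrow> real^4) \<Rightarrow> real \<Rightarrow> real^2^2" where
  "frame_A \<gamma> x = (let u = \<gamma> x; u' = dx \<gamma> x in
     (1 / (u $ 3 * normJ u')) *\<^sub>R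
       vector [vector [u $ 3 * u' $ 1 - u $ 1 * u' $ 3, u $ 3 * u' $ 2 - u $ 2 * u' $ 3],
               vector [u $ 2 * u' $ 3 - u $ 3 * u' $ 2, u $ 3 * u' $ 1 - u $ 1 * u' $ 3]])"

definition frame_xi :: "(real \<Rightarrow> real^4) \<Rightarrow> real \<Rightarrow> real^2" where
  "frame_xi \<gamma> x = vector
     [- (dx \<gamma> x $ 3) / (\<gamma> x $ 3 * normJ (dx \<gamma> x)),
      - det3 (\<gamma> x) (dx \<gamma> x) ((dx ^^ 2) \<gamma> x) / (\<gamma> x $ 3 * (normJ (dx \<gamma> x)) ^ 3)]"

text \<open>The $3\times 3$ block matrix with blocks \<open>B\<close> and \<open>hat u\<close> over \<open>- u\<^sub>3 \<xi>\<^sup>T\<close> and \<open>u\<^sub>3\<close>.\<close>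

definition flow_matrix :: "(real \<Rightarrow> real^4) \<Rightarrow> real \<Rightarrow> real^3^3" where
  "flow_matrix \<gamma> x = (let u = \<gamma> x; \<xi> = frame_xi \<gamma> x;
       B = matrix_inv (frame_A \<gamma> x) - (\<chi> i j. hat u $ i * \<xi> $ j) in
     vector [vector [B $ 1 $ 1, B $ 1 $ 2, hat u $ 1],
             vector [B $ 2 $ 1, B $ 2 $ 2, hat u $ 2],
             vector [- u $ 3 * \<xi> $ 1, - u $ 3 * \<xi> $ 2, u $ 3]])"


section \<open>Smooth families of curves\<close>

text \<open>
  A family of curves is a function of the time \<open>t\<close>, ranging over an interval \<open>I\<close>, and of the
  parameter \<open>x\<close>. Time derivatives are taken within \<open>I\<close>, i.e. they are one-sided at an end point
  belonging to \<open>I\<close>.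
\<close>

definition partial_x :: "(real \<Rightarrow> real \<Rightarrow> 'a::real_normed_vector) \<Rightarrow> real \<Rightarrow> real \<Rightarrow> 'a" where
  "partial_x f t x = vector_derivative (f t) (at x)"

definition partial_t :: "real set \<Rightarrow> (real \<Rightarrow> real \<Rightarrow> 'a::real_normed_vector) \<Rightarrow> real \<Rightarrow> real \<Rightarrow> 'a" where
  "partial_t I f t x = vector_derivative (\<lambda>s. f s x) (at t within I)"

primrec Ck_family :: "nat \<Rightarrow> real set \<Rightarrow> (real \<Rightarrow> real \<Rightarrow> 'a::real_normed_vector) \<Rightarrow> bool" where
  "Ck_family 0 I f \<longleftrightarrow> continuous_on (I \<times> UNIV) (\<lambda>(t, x). f t x)"
| "Ck_family (Suc n) I f \<longleftrightarrow>
     continuous_on (I \<times> UNIV) (\<lambda>(t, x). f t x) \<and>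
     (\<forall>t\<in>I. \<forall>x. (f t) differentiable (at x)) \<and>
     (\<forall>t\<in>I. \<forall>x. (\<lambda>s. f s x) differentiable (at t within I)) \<and>
     Ck_family n I (partial_x f) \<and> Ck_family n I (partial_t I f)"

definition smooth_family :: "real set \<Rightarrow> (real \<Rightarrow> real \<Rightarrow> 'a::real_normed_vector) \<Rightarrow> bool" where
  "smooth_family I f \<longleftrightarrow> (\<forall>n. Ck_family n I f)"


section \<open>Functionals on smooth functions on the circle\<close>

definition smooth_periodic :: "real \<Rightarrow> (real \<Rightarrow> real) \<Rightarrow> bool" where
  "smooth_periodic L f \<longleftrightarrow> (\<forall>x. f (x + L) = f x) \<and> (\<forall>n x. ((dx ^^ n) f) differentiable (at x))"

text \<open>
  \<open>g\<close> is the variational derivative of \<open>F\<close> at \<open>f\<close> with respect to the \<open>L\<^sup>2\<close> pairing on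
  $\mathbb{R}/L\mathbb{Z}$.
\<close>

definition has_variational_derivative ::
    "real \<Rightarrow> ((real \<Rightarrow> real) \<Rightarrow> real) \<Rightarrow> (real \<Rightarrow> real) \<Rightarrow> (real \<Rightarrow> real) \<Rightarrow> bool" where
  "has_variational_derivative L F f g \<longleftrightarrow> smooth_periodic L g \<and>
     (\<forall>\<phi>. smooth_periodic L \<phi> \<longrightarrow>
       ((\<lambda>\<epsilon>. F (\<lambda>x. f x + \<epsilon> * \<phi> x)) has_real_derivative integral {0..L} (\<lambda>x. g x * \<phi> x)) (at 0))"

definition hamiltonian :: "real \<Rightarrow> (real \<Rightarrow> real) \<Rightarrow> (real \<Rightarrow> real) \<Rightarrow> real" where
  "hamiltonian L f g = 1 / 2 * integral {0..L} (\<lambda>x. (f x)\<^sup>2 + (g x)\<^sup>2)"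

end

theory Submission
  imports Defs
begin

text \<open>
  A point of the upper cone is \<open>u = r (\<bar>z\<bar>\<^sup>2 / 2, z, 1)\<close> with the complex affine coordinate
  \<open>z = (u\<^sub>1 + \<i> u\<^sub>2) / u\<^sub>3\<close> and \<open>r = u\<^sub>3 > 0\<close>, so a curve on the cone is a curve \<open>z\<close> in the
  complex plane together with a positive function \<open>r\<close>. In these coordinates \<open>k\<^sub>0 = r \<bar>z'\<bar>\<close>, and the
  inverse of the matrix \<open>A\<close> is multiplication by the unit complex number \<open>z' / \<bar>z'\<bar>\<close>. The flow
  therefore reads \<open>z\<^sub>t = z' (k\<^sub>1 + \<i> k\<^sub>2) / k\<^sub>0\<close> (\<open>curvatures_eq\<close>), together with an equation for \<open>r\<^sub>t\<close>
  (\<open>partial_t_r\<close>).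

  Differentiating \<open>r \<bar>z'\<bar>\<close> in time, all terms cancel except for
  \<open>(k\<^sub>0)\<^sub>t = k\<^sub>1' (1 - k\<^sub>0)\<close> (\<open>k0_evolution\<close>). For fixed \<open>x\<close> this is a linear homogeneous ordinary
  differential equation for \<open>k\<^sub>0 - 1\<close>, hence \<open>k\<^sub>0 = 1\<close> is preserved (\<open>arc_length_preserved\<close>).

  For a curve of unit speed, \<open>r = 1 / \<bar>z'\<bar>\<close> is determined by \<open>z\<close>, and the remaining
  invariants are the two parts of the Schwarzian derivative \<open>S\<close> of \<open>z\<close>: \<open>k\<^sub>1 = - Re S\<close> and
  \<open>k\<^sub>2 = Im S\<close> (\<open>curvatures_schwarzian\<close>). So the flow becomes \<open>z\<^sub>t = - z' cnj S\<close>. For every motion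
  \<open>z\<^sub>t = z' f\<close> one has \<open>S\<^sub>t = f S' + 2 f' S + f'''\<close> (\<open>schwarzian_evolution\<close>); with \<open>f = - cnj S\<close> the
  real and imaginary parts of this identity are the two coupled KdV equations
  (\<open>curvature_evolution\<close>).

  The analytic input is the symmetry of the mixed partial derivatives up to the end points of the
  time interval (\<open>partial_commute\<close>), where the time derivative is one-sided.
\<close>

section \<open>Calculus of smooth families\<close>

lemma has_vector_derivative_inverse:
  fixes f :: "real \<Rightarrow> 'a::real_normed_field"
  assumes "(f has_vector_derivative d) (at x within S)" and "f x \<noteq> 0"
  shows "((\<lambda>y. inverse (f y)) has_vector_derivative - (d * (inverse (f x) * inverse (f x)))) (at x within S)"
  using Deriv.has_derivative_inverse[OF assms(2) assms(1)[unfolded has_vector_derivative_def]]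
  by (simp add: has_vector_derivative_def mult.commute mult.left_commute)

locale time_interval =
  fixes I :: "real set"
  assumes interval: "is_interval I" and nondegenerate: "interior I \<noteq> {}"
begin

text \<open>
This makes derivatives in \<open>t\<close> within \<open>I\<close> unique, also at the end points.
\<close>

lemma at_within_neq_bot: "t \<in> I \<Longrightarrow> at t within I \<noteq> bot"
proof -
  assume t: "t \<in> I"
  have "I \<noteq> {y}" for y
    using nondegenerate by auto
  then have "t islimpt I"
    using connected_imp_perfect t interval is_interval_connected by blast
  then show ?thesis
    by (simp add: trivial_limit_within)
qed

lemma partial_tI:
  "t \<in> I \<Longrightarrow> ((\<lambda>s. f s x) has_vector_derivative d) (at t within I) \<Longrightarrow> partial_t I f t x = d"
  unfolding partial_t_def using vector_derivative_within at_within_neq_bot by blast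

lemma partial_xI:
  "(f t has_vector_derivative d) (at x) \<Longrightarrow> partial_x f t x = d"
  unfolding partial_x_def by (rule vector_derivative_at)

lemma partial_t_cong:
  assumes "t \<in> I" and "\<And>s y. s \<in> I \<Longrightarrow> f s y = g s y"
  shows "partial_t I f t x = partial_t I g t x"
proof -
  have "((\<lambda>s. f s x) has_vector_derivative d) (at t within I) \<longleftrightarrow>
        ((\<lambda>s. g s x) has_vector_derivative d) (at t within I)" for d
    unfolding has_vector_derivative_def
    using assms has_derivative_transform[of t I "\<lambda>s. f s x" "\<lambda>s. g s x"]
      has_derivative_transform[of t I "\<lambda>s. g s x" "\<lambda>s. f s x"] by auto
  then show ?thesis
    unfolding partial_t_def vector_derivative_def by simp
qed

lemma partial_x_cong:
  assumes "\<And>y. f t y = g t y"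
  shows "partial_x f t x = partial_x g t x"
proof -
  have "f t = g t" using assms by auto
  then show ?thesis by (simp add: partial_x_def)
qed

text \<open>
Values at times outside \<open>I\<close> are irrelevant for every derivative occurring in the definition. So
families may be replaced by formulas for them that hold only on \<open>I\<close>.
\<close>

lemma Ck_family_cong:
  assumes "Ck_family n I f" and "\<And>t x. t \<in> I \<Longrightarrow> g t x = f t x"
  shows "Ck_family n I g"
  using assms
proof (induction n arbitrary: f g)
  case 0
  have "continuous_on (I \<times> UNIV) (\<lambda>(t, x). g t x) = continuous_on (I \<times> UNIV) (\<lambda>(t, x). f t x)"
    by (rule continuous_on_cong) (auto simp: 0)
  with 0 show ?case by simp
next
  case (Suc n)
  have eq: "g t = f t" if "t \<in> I" for t
    using Suc.prems(2) that by auto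
  have c: "continuous_on (I \<times> UNIV) (\<lambda>(t, x). g t x) = continuous_on (I \<times> UNIV) (\<lambda>(t, x). f t x)"
    by (rule continuous_on_cong) (auto simp: eq)
  have d: "(\<lambda>s. g s x) differentiable (at t within I)" if "t \<in> I" for t x
  proof -
    have "(\<lambda>s. f s x) differentiable (at t within I)"
      using Suc.prems(1) that by simp
    then obtain f' where "((\<lambda>s. f s x) has_derivative f') (at t within I)"
      unfolding differentiable_def by blast
    then have "((\<lambda>s. g s x) has_derivative f') (at t within I)"
      by (rule has_derivative_transform[rotated 2]) (auto simp: that Suc.prems(2))
    then show ?thesis by (auto simp: differentiable_def)
  qed
  have "Ck_family n I (partial_x g)"
    proof (rule Suc.IH)
    show "Ck_family n I (partial_x f)"
      using Suc.prems(1) by simp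
    show "partial_x g t x = partial_x f t x" if "t \<in> I" for t x
      using eq[OF that] by (simp add: partial_x_def)
  qed
  moreover have "Ck_family n I (partial_t I g)"
    by (rule Suc.IH[of "partial_t I f"])
      (use Suc.prems in \<open>auto intro: partial_t_cong\<close>)
  ultimately show ?case
    using Suc.prems(1) c d eq by simp
qed

lemma Ck_family_Suc_D: "Ck_family (Suc n) I f \<Longrightarrow> Ck_family n I f"
proof (induction n arbitrary: f)
  case 0
  then show ?case by simp
next
  case (Suc n)
  have "Ck_family n I (partial_x f)" and "Ck_family n I (partial_t I f)"
    using Suc.prems by (intro Suc.IH; simp only: Ck_family.simps(2)[of "Suc n"])+
  with Suc.prems show ?case
    unfolding Ck_family.simps(2)[of n] Ck_family.simps(2)[of "Suc n"]
    by (elim conjE) (intro conjI; assumption)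
qed

lemma Ck_family_imp_continuous: "Ck_family n I f \<Longrightarrow> continuous_on (I \<times> UNIV) (\<lambda>(t, x). f t x)"
  by (cases n) auto

lemma Ck_family_derivs:
  assumes "Ck_family (Suc n) I f" and "t \<in> I"
  shows Ck_family_deriv_x: "(f t has_vector_derivative partial_x f t x) (at x)"
    and Ck_family_deriv_t: "((\<lambda>s. f s x) has_vector_derivative partial_t I f t x) (at t within I)"
  using assms by (auto simp: partial_x_def partial_t_def vector_derivative_works)

text \<open>
The form in which differentiability classes are established below: one exhibits both partial
derivatives as families of the next lower class.
\<close>

lemma Ck_family_SucI:
  assumes "continuous_on (I \<times> UNIV) (\<lambda>(t, x). f t x)"
    and "\<And>t x. t \<in> I \<Longrightarrow> (f t has_vector_derivative fx t x) (at x)"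
    and "\<And>t x. t \<in> I \<Longrightarrow> ((\<lambda>s. f s x) has_vector_derivative ft t x) (at t within I)"
    and "Ck_family n I fx" and "Ck_family n I ft"
  shows "Ck_family (Suc n) I f"
proof -
  have "Ck_family n I (partial_x f)"
    using assms(4) by (rule Ck_family_cong) (use assms(2) in \<open>auto intro: partial_xI\<close>)
  moreover have "Ck_family n I (partial_t I f)"
    using assms(5) by (rule Ck_family_cong) (use assms(3) in \<open>auto intro: partial_tI\<close>)
  moreover have "\<forall>t\<in>I. \<forall>x. f t differentiable (at x)"
    using assms(2) differentiableI_vector by blast
  moreover have "\<forall>t\<in>I. \<forall>x. (\<lambda>s. f s x) differentiable (at t within I)"
    using assms(3) differentiableI_vector by blast
  ultimately show ?thesis
    using assms(1) by simp
qed

lemma Ck_family_add: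
  "Ck_family n I f \<Longrightarrow> Ck_family n I g \<Longrightarrow> Ck_family n I (\<lambda>t x. f t x + g t x)"
proof (induction n arbitrary: f g)
  case 0
  then show ?case by (auto simp: case_prod_unfold intro!: continuous_intros)
next
  case (Suc n)
  note f = Ck_family_derivs[OF Suc.prems(1)] and g = Ck_family_derivs[OF Suc.prems(2)]
  show ?case
  proof (rule Ck_family_SucI)
    show "continuous_on (I \<times> UNIV) (\<lambda>(t, x). f t x + g t x)"
      using Suc.prems[THEN Ck_family_imp_continuous]
      by (auto simp: case_prod_unfold intro!: continuous_intros)
    show "((\<lambda>x. f t x + g t x) has_vector_derivative partial_x f t x + partial_x g t x) (at x)"
      if "t \<in> I" for t x
      using f(1)[OF that] g(1)[OF that] by (rule has_vector_derivative_add)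
    show "((\<lambda>s. f s x + g s x) has_vector_derivative partial_t I f t x + partial_t I g t x)
          (at t within I)" if "t \<in> I" for t x
      using f(2)[OF that] g(2)[OF that] by (rule has_vector_derivative_add)
  qed (use Suc in auto)
qed

lemma Ck_family_linear:
  assumes "bounded_linear h"
  shows "Ck_family n I f \<Longrightarrow> Ck_family n I (\<lambda>t x. h (f t x))"
proof (induction n arbitrary: f)
  case 0
  then show ?case
    by (auto simp: case_prod_unfold intro!: bounded_linear.continuous_on[OF assms])
next
  case (Suc n)
  note f = Ck_family_derivs[OF Suc.prems(1)]
  show ?case
  proof (rule Ck_family_SucI)
    show "continuous_on (I \<times> UNIV) (\<lambda>(t, x). h (f t x))"
      using Ck_family_imp_continuous[OF Suc.prems]
      by (auto simp: case_prod_unfold intro!: bounded_linear.continuous_on[OF assms])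
    show "((\<lambda>x. h (f t x)) has_vector_derivative h (partial_x f t x)) (at x)"
      if "t \<in> I" for t x
      using f(1)[OF that] by (rule bounded_linear.has_vector_derivative[OF assms])
    show "((\<lambda>s. h (f s x)) has_vector_derivative h (partial_t I f t x)) (at t within I)"
      if "t \<in> I" for t x
      using f(2)[OF that] by (rule bounded_linear.has_vector_derivative[OF assms])
  qed (use Suc in auto)
qed

lemma Ck_family_mult:
  fixes f g :: "real \<Rightarrow> real \<Rightarrow> 'a::real_normed_algebra"
  shows "Ck_family n I f \<Longrightarrow> Ck_family n I g \<Longrightarrow> Ck_family n I (\<lambda>t x. f t x * g t x)"
proof (induction n arbitrary: f g)
  case 0
  then show ?case by (auto simp: case_prod_unfold intro!: continuous_intros)
next
  case (Suc n)
  note f = Ck_family_derivs[OF Suc.prems(1)] and g = Ck_family_derivs[OF Suc.prems(2)]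
  note low = Suc.prems[THEN Ck_family_Suc_D]
  show ?case
  proof (rule Ck_family_SucI)
    show "continuous_on (I \<times> UNIV) (\<lambda>(t, x). f t x * g t x)"
      using Suc.prems[THEN Ck_family_imp_continuous]
      by (auto simp: case_prod_unfold intro!: continuous_intros)
    show "((\<lambda>x. f t x * g t x) has_vector_derivative f t x * partial_x g t x + partial_x f t x * g t x) (at x)"
      if "t \<in> I" for t x
      using f(1)[OF that] g(1)[OF that] by (rule has_vector_derivative_mult)
    show "((\<lambda>s. f s x * g s x) has_vector_derivative f t x * partial_t I g t x + partial_t I f t x * g t x)
          (at t within I)" if "t \<in> I" for t x
      using f(2)[OF that] g(2)[OF that] by (rule has_vector_derivative_mult)
    show "Ck_family n I (\<lambda>t x. f t x * partial_x g t x + partial_x f t x * g t x)"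
      using Suc low by (auto intro!: Ck_family_add)
    show "Ck_family n I (\<lambda>t x. f t x * partial_t I g t x + partial_t I f t x * g t x)"
      using Suc low by (auto intro!: Ck_family_add)
  qed
qed

text \<open>
The derivative of an inverse is again a polynomial in the inverse and in the derivative of the
original family, which is what lets the induction close.
\<close>

lemma Ck_family_inverse:
  fixes f :: "real \<Rightarrow> real \<Rightarrow> 'a::real_normed_field"
  assumes nz: "\<And>t x. t \<in> I \<Longrightarrow> f t x \<noteq> 0"
  shows "Ck_family n I f \<Longrightarrow> Ck_family n I (\<lambda>t x. inverse (f t x))"
proof (induction n)
  case 0
  then show ?case using nz by (auto simp: case_prod_unfold intro!: continuous_intros)
next
  case (Suc n)
  note f = Ck_family_derivs[OF Suc.prems(1)]
  have inv: "Ck_family n I (\<lambda>t x. inverse (f t x))"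
    using Suc.IH Suc.prems Ck_family_Suc_D by blast
  have neg: "Ck_family n I (\<lambda>t x. - g t x)" if "Ck_family n I g" for g :: "real \<Rightarrow> real \<Rightarrow> 'a"
    using Ck_family_linear[OF bounded_linear_minus[OF bounded_linear_ident] that] .
  show ?case
  proof (rule Ck_family_SucI)
    show "continuous_on (I \<times> UNIV) (\<lambda>(t, x). inverse (f t x))"
      using Ck_family_imp_continuous[OF Suc.prems] nz
      by (auto simp: case_prod_unfold intro!: continuous_intros)
    show "((\<lambda>x. inverse (f t x)) has_vector_derivative
        - (partial_x f t x * (inverse (f t x) * inverse (f t x)))) (at x)"
      if "t \<in> I" for t x
      using f(1)[OF that] nz[OF that] by (rule has_vector_derivative_inverse)
    show "((\<lambda>s. inverse (f s x)) has_vector_derivative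
        - (partial_t I f t x * (inverse (f t x) * inverse (f t x)))) (at t within I)"
      if "t \<in> I" for t x
      using f(2)[OF that] nz[OF that] by (rule has_vector_derivative_inverse)
  qed (use Suc.prems inv in \<open>auto intro!: neg Ck_family_mult\<close>)
qed

named_theorems smooth_intros

lemma smooth_add [smooth_intros]:
  "smooth_family I f \<Longrightarrow> smooth_family I g \<Longrightarrow> smooth_family I (\<lambda>t x. f t x + g t x)"
  by (auto simp: smooth_family_def intro: Ck_family_add)

lemma smooth_linear:
  "bounded_linear h \<Longrightarrow> smooth_family I f \<Longrightarrow> smooth_family I (\<lambda>t x. h (f t x))"
  by (auto simp: smooth_family_def intro: Ck_family_linear)

lemma smooth_minus [smooth_intros]:
  "smooth_family I f \<Longrightarrow> smooth_family I (\<lambda>t x. - f t x)"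
  by (rule smooth_linear[OF bounded_linear_minus[OF bounded_linear_ident]])

lemma smooth_diff [smooth_intros]:
  "smooth_family I f \<Longrightarrow> smooth_family I g \<Longrightarrow> smooth_family I (\<lambda>t x. f t x - g t x)"
  using smooth_add[OF _ smooth_minus] by fastforce

lemma smooth_mult [smooth_intros]:
  fixes f g :: "real \<Rightarrow> real \<Rightarrow> 'a::real_normed_algebra"
  shows "smooth_family I f \<Longrightarrow> smooth_family I g \<Longrightarrow> smooth_family I (\<lambda>t x. f t x * g t x)"
  by (auto simp: smooth_family_def intro: Ck_family_mult)

lemma smooth_divide:
  fixes f g :: "real \<Rightarrow> real \<Rightarrow> 'a::real_normed_field"
  assumes "smooth_family I f" and "smooth_family I g" and "\<And>t x. t \<in> I \<Longrightarrow> g t x \<noteq> 0"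
  shows "smooth_family I (\<lambda>t x. f t x / g t x)"
  using assms Ck_family_inverse[of g]
  by (auto simp: smooth_family_def divide_inverse intro!: Ck_family_mult)

lemma smooth_cong:
  "smooth_family I f \<Longrightarrow> (\<And>t x. t \<in> I \<Longrightarrow> g t x = f t x) \<Longrightarrow> smooth_family I g"
  unfolding smooth_family_def using Ck_family_cong by metis

lemma smooth_partial_x [smooth_intros]: "smooth_family I f \<Longrightarrow> smooth_family I (partial_x f)"
  unfolding smooth_family_def by (metis Ck_family.simps(2))

lemma smooth_partial_t [smooth_intros]: "smooth_family I f \<Longrightarrow> smooth_family I (partial_t I f)"
  unfolding smooth_family_def by (metis Ck_family.simps(2))

lemma smooth_deriv_x:
  "smooth_family I f \<Longrightarrow> t \<in> I \<Longrightarrow> (f t has_vector_derivative partial_x f t x) (at x)"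
  unfolding smooth_family_def using Ck_family_deriv_x by blast

lemma smooth_deriv_t:
  "smooth_family I f \<Longrightarrow> t \<in> I \<Longrightarrow>
    ((\<lambda>s. f s x) has_vector_derivative partial_t I f t x) (at t within I)"
  unfolding smooth_family_def using Ck_family_deriv_t by blast

lemma smooth_continuous_t:
  assumes "smooth_family I f" and "S \<subseteq> I"
  shows "continuous_on S (\<lambda>t. f t x)"
proof -
  have "continuous_on (I \<times> UNIV) (\<lambda>(t, x). f t x)"
    using assms(1) Ck_family_imp_continuous unfolding smooth_family_def by blast
  then have "continuous_on ((\<lambda>t. (t, x)) ` S) (\<lambda>(t, x). f t x)"
    by (rule continuous_on_subset) (use assms in auto)
  moreover have "continuous_on S (\<lambda>t. (t, x))"
    by (intro continuous_intros)
  ultimately show ?thesis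
    using continuous_on_compose2 by fastforce
qed

text \<open>
One-sided and two-sided derivatives are treated alike by passing to a compact interval that is a
neighbourhood of \<open>t\<close> in \<open>I\<close>; it has \<open>t\<close> as an end point exactly if \<open>t\<close> is an end point of \<open>I\<close>.
\<close>

lemma closed_neighbourhood:
  assumes "t \<in> I"
  obtains a b where "a \<le> t" "t \<le> b" "a \<in> I" "{a..b} \<subseteq> I" "at t within I = at t within {a..b}"
proof -
  obtain a where a: "a \<in> I" "a \<le> t" "a = t \<Longrightarrow> \<forall>s\<in>I. t \<le> s"
    using assms by (cases "\<forall>s\<in>I. t \<le> s") (auto simp: not_le intro: less_imp_le)
  obtain b where b: "b \<in> I" "t \<le> b" "b = t \<Longrightarrow> \<forall>s\<in>I. s \<le> t"
    using assms by (cases "\<forall>s\<in>I. s \<le> t") (auto simp: not_le intro: less_imp_le)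
  have sub: "{a..b} \<subseteq> I"
    using mem_is_interval_1_I[OF interval a(1) b(1)] by auto
  \<comment> \<open>if \<open>t\<close> is an end point of \<open>I\<close>, the bound on that side only has to lie beyond \<open>t\<close>\<close>
  define S where "S = {(if a = t then t - 1 else a)<..<(if b = t then t + 1 else b)}"
  have "open S" "t \<in> S"
    using a b by (auto simp: S_def)
  moreover have "a \<le> s \<and> s \<le> b" if "s \<in> I" "s \<in> S" for s
    using a(3) b(3) that by (auto simp: S_def split: if_splits)
  then have "I \<inter> S - {t} = {a..b} \<inter> S - {t}"
    using sub by auto
  ultimately have "at t within I = at t within {a..b}"
    by (intro at_within_nhd)
  with a b sub show ?thesis by (intro that)
qed

text \<open>
Write \<open>f\<close> at time \<open>s\<close> as its value at a fixed time \<open>a\<close> plus the integral of its time derivative,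
differentiate under the integral sign in \<open>x\<close>, and recover the integrand by differentiating in
\<open>s\<close>. The argument does not distinguish between interior points and end points of \<open>I\<close>.
\<close>

lemma partial_commute:
  fixes f :: "real \<Rightarrow> real \<Rightarrow> 'a::banach"
  assumes f: "smooth_family I f" and t: "t \<in> I"
  shows "partial_t I (partial_x f) t x = partial_x (partial_t I f) t x"
proof -
  obtain a b where ab: "a \<le> t" "t \<le> b" "a \<in> I" "{a..b} \<subseteq> I"
    and at: "at t within I = at t within {a..b}"
    using closed_neighbourhood[OF t] by metis
  let ?g = "partial_t I f"
  have g: "smooth_family I ?g" "smooth_family I (partial_x ?g)"
    using f by (auto intro!: smooth_intros)
  have sub: "{a..s} \<subseteq> I" if "s \<in> {a..b}" for s
    using ab that by auto
  have ftc: "f s y = f a y + integral {a..s} (\<lambda>\<tau>. ?g \<tau> y)" if s: "s \<in> {a..b}" for s y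
  proof -
    have "((\<lambda>\<tau>. ?g \<tau> y) has_integral f s y - f a y) {a..s}"
    proof (rule fundamental_theorem_of_calculus)
      show "((\<lambda>s. f s y) has_vector_derivative ?g \<tau> y) (at \<tau> within {a..s})" if "\<tau> \<in> {a..s}" for \<tau>
        by (rule has_vector_derivative_within_subset[OF smooth_deriv_t[OF f]])
          (use sub[OF s] that in auto)
    qed (use s in auto)
    then show ?thesis by (simp add: integral_unique)
  qed
  have px: "partial_x f s x = partial_x f a x + integral {a..s} (\<lambda>\<tau>. partial_x ?g \<tau> x)"
    if s: "s \<in> {a..b}" for s
  proof (rule partial_xI)
    have "((\<lambda>y. integral (cbox a s) (\<lambda>\<tau>. ?g \<tau> y)) has_vector_derivative
        integral (cbox a s) (\<lambda>\<tau>. partial_x ?g \<tau> x)) (at x within UNIV)"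
    proof (rule leibniz_rule_vector_derivative)
      show "((\<lambda>x. ?g \<tau> x) has_vector_derivative partial_x ?g \<tau> y) (at y within UNIV)"
        if "\<tau> \<in> cbox a s" for y \<tau>
        using smooth_deriv_x[OF g(1)] sub[OF s] that by auto
      show "(\<lambda>\<tau>. ?g \<tau> y) integrable_on cbox a s" for y
        using smooth_continuous_t[OF g(1) sub[OF s]] by (auto intro: integrable_continuous_real)
      have "continuous_on (I \<times> UNIV) (\<lambda>p. partial_x ?g (fst p) (snd p))"
        using g(2) Ck_family_imp_continuous unfolding smooth_family_def case_prod_unfold by blast
      then have "continuous_on (UNIV \<times> cbox a s) (\<lambda>p. partial_x ?g (fst (snd p, fst p)) (snd (snd p, fst p)))"
        by (rule continuous_on_compose2) (use sub[OF s] in \<open>auto intro!: continuous_intros\<close>)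
      then show "continuous_on (UNIV \<times> cbox a s) (\<lambda>(y, \<tau>). partial_x ?g \<tau> y)"
        by (simp add: case_prod_unfold)
    qed auto
    then have "((\<lambda>y. f a y + integral {a..s} (\<lambda>\<tau>. ?g \<tau> y)) has_vector_derivative
        partial_x f a x + integral {a..s} (\<lambda>\<tau>. partial_x ?g \<tau> x)) (at x)"
      using smooth_deriv_x[OF f \<open>a \<in> I\<close>] by (auto intro: has_vector_derivative_add)
    then show "(f s has_vector_derivative partial_x f a x + integral {a..s} (\<lambda>\<tau>. partial_x ?g \<tau> x)) (at x)"
      by (simp add: ftc[OF s, symmetric])
  qed
  have "((\<lambda>s. partial_x f a x + integral {a..s} (\<lambda>\<tau>. partial_x ?g \<tau> x)) has_vector_derivative
      0 + partial_x ?g t x) (at t within {a..b})"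
    by (intro has_vector_derivative_add has_vector_derivative_const integral_has_vector_derivative)
      (use ab in \<open>auto intro!: smooth_continuous_t[OF g(2)]\<close>)
  then have "((\<lambda>s. partial_x f s x) has_vector_derivative partial_x ?g t x) (at t within {a..b})"
    unfolding has_vector_derivative_def add_0
    by (rule has_derivative_transform[rotated 2]) (simp add: ab, rule px)
  then show ?thesis
    by (intro partial_tI[OF t]) (simp add: at)
qed

lemma partial_mult:
  fixes f g :: "real \<Rightarrow> real \<Rightarrow> 'a::real_normed_algebra"
  assumes "smooth_family I f" and "smooth_family I g" and "t \<in> I"
  shows partial_x_mult: "partial_x (\<lambda>t x. f t x * g t x) t x = f t x * partial_x g t x + partial_x f t x * g t x"
    and partial_t_mult: "partial_t I (\<lambda>t x. f t x * g t x) t x = f t x * partial_t I g t x + partial_t I f t x * g t x"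
  using assms by (auto intro!: partial_xI partial_tI has_vector_derivative_mult smooth_deriv_x smooth_deriv_t)

lemma partial_x_add:
  assumes "smooth_family I f" and "smooth_family I g" and "t \<in> I"
  shows "partial_x (\<lambda>t x. f t x + g t x) t x = partial_x f t x + partial_x g t x"
  using assms by (auto intro!: partial_xI has_vector_derivative_add smooth_deriv_x)

lemma partial_linear:
  assumes "bounded_linear h" and "smooth_family I f" and "t \<in> I"
  shows partial_x_linear: "partial_x (\<lambda>t x. h (f t x)) t x = h (partial_x f t x)"
    and partial_t_linear: "partial_t I (\<lambda>t x. h (f t x)) t x = h (partial_t I f t x)"
  by (intro partial_xI bounded_linear.has_vector_derivative[OF assms(1)] smooth_deriv_x[OF assms(2,3)])
    (intro partial_tI[OF assms(3)] bounded_linear.has_vector_derivative[OF assms(1)] smooth_deriv_t[OF assms(2,3)])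

lemma real_derivs:
  assumes "t \<in> I"
  shows "smooth_family I f \<Longrightarrow> (f t has_real_derivative partial_x f t x) (at x)"
    and "smooth_family I g \<Longrightarrow> ((\<lambda>x. Re (g t x)) has_real_derivative Re (partial_x g t x)) (at x)"
    and "smooth_family I g \<Longrightarrow> ((\<lambda>x. Im (g t x)) has_real_derivative Im (partial_x g t x)) (at x)"
    and "smooth_family I h \<Longrightarrow> ((\<lambda>x. h t x $ i) has_real_derivative partial_x h t x $ i) (at x)"
    and "smooth_family I f \<Longrightarrow> ((\<lambda>s. f s x) has_real_derivative partial_t I f t x) (at t within I)"
    and "smooth_family I g \<Longrightarrow> ((\<lambda>s. Re (g s x)) has_real_derivative Re (partial_t I g t x)) (at t within I)"
    and "smooth_family I g \<Longrightarrow> ((\<lambda>s. Im (g s x)) has_real_derivative Im (partial_t I g t x)) (at t within I)"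
    and "smooth_family I h \<Longrightarrow> ((\<lambda>s. h s x $ i) has_real_derivative partial_t I h t x $ i) (at t within I)"
  unfolding has_real_derivative_iff_has_vector_derivative
  using assms
  by (auto intro: smooth_deriv_x smooth_deriv_t bounded_linear.has_vector_derivative[OF bounded_linear_Re]
      bounded_linear.has_vector_derivative[OF bounded_linear_Im]
      bounded_linear.has_vector_derivative[OF bounded_linear_vec_nth])

end

section \<open>The Schwarzian derivative of a moving planar curve\<close>

definition log_deriv :: "(real \<Rightarrow> real \<Rightarrow> complex) \<Rightarrow> real \<Rightarrow> real \<Rightarrow> complex" where
  "log_deriv z t x = partial_x (partial_x z) t x / partial_x z t x"

text \<open>
With \<open>q = z'' / z'\<close> the classical Schwarzian derivative is \<open>q' - q\<^sup>2 / 2\<close>; this form has simpler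
derivatives than the one in terms of \<open>z'''\<close>, for which see \<open>schwarzian_eq\<close>.
\<close>

definition schwarzian :: "(real \<Rightarrow> real \<Rightarrow> complex) \<Rightarrow> real \<Rightarrow> real \<Rightarrow> complex" where
  "schwarzian z t x = partial_x (log_deriv z) t x - (log_deriv z t x)\<^sup>2 / 2"

context time_interval
begin

context
  fixes z :: "real \<Rightarrow> real \<Rightarrow> complex"
  assumes z: "smooth_family I z" and immersed: "\<And>t x. t \<in> I \<Longrightarrow> partial_x z t x \<noteq> 0"
begin

abbreviation (input) "q \<equiv> log_deriv z"
abbreviation (input) "p \<equiv> partial_x z"

lemma smooth_log_deriv: "smooth_family I q"
  unfolding log_deriv_def[abs_def] by (intro smooth_divide smooth_intros z immersed)

lemma smooth_schwarzian: "smooth_family I (schwarzian z)"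
  unfolding schwarzian_def[abs_def] power2_eq_square
  by (intro smooth_intros smooth_linear[OF bounded_linear_divide] smooth_log_deriv)

lemma log_deriv_mult: "t \<in> I \<Longrightarrow> q t x * p t x = partial_x p t x"
  using immersed by (simp add: log_deriv_def)

lemma partial_x_log_deriv:
  assumes t: "t \<in> I"
  shows "partial_x q t x = partial_x (partial_x p) t x / p t x - (q t x)\<^sup>2"
proof -
  have "partial_x (partial_x p) t x = partial_x (\<lambda>t x. q t x * p t x) t x"
    by (intro partial_x_cong) (simp add: log_deriv_mult[OF t])
  also have "\<dots> = q t x * partial_x p t x + partial_x q t x * p t x"
    by (intro partial_x_mult smooth_log_deriv smooth_intros z t)
  finally show ?thesis
    using immersed[OF t, of x] log_deriv_mult[OF t, of x]
    by (simp add: field_simps power2_eq_square)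
qed

lemma schwarzian_eq:
  assumes t: "t \<in> I"
  shows "schwarzian z t x = partial_x (partial_x p) t x / p t x - 3 / 2 * (partial_x p t x / p t x)\<^sup>2"
  unfolding schwarzian_def partial_x_log_deriv[OF t] by (simp add: log_deriv_def)

lemma schwarzian_deriv:
  assumes t: "t \<in> I"
  shows "partial_x (schwarzian z) t x = partial_x (partial_x q) t x - q t x * partial_x q t x"
    and "partial_t I (schwarzian z) t x = partial_x (partial_t I q) t x - q t x * partial_t I q t x"
proof -
  note q = smooth_log_deriv
  show "partial_x (schwarzian z) t x = partial_x (partial_x q) t x - q t x * partial_x q t x"
    unfolding schwarzian_def[abs_def]
    by (rule partial_xI)
      (auto intro!: derivative_eq_intros smooth_deriv_x[OF _ t] smooth_partial_x q simp: power2_eq_square)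
  show "partial_t I (schwarzian z) t x = partial_x (partial_t I q) t x - q t x * partial_t I q t x"
    unfolding schwarzian_def[abs_def] partial_commute[OF q t, symmetric]
    by (rule partial_tI[OF t])
      (auto intro!: derivative_eq_intros smooth_deriv_t[OF _ t] smooth_partial_x q simp: power2_eq_square)
qed

context
  fixes f :: "real \<Rightarrow> real \<Rightarrow> complex"
  assumes f: "smooth_family I f" and motion: "\<And>t x. t \<in> I \<Longrightarrow> partial_t I z t x = f t x * p t x"
begin

lemma partial_t_deriv:
  assumes t: "t \<in> I"
  shows "partial_t I p t x = f t x * partial_x p t x + partial_x f t x * p t x"
proof -
  have "partial_t I p t x = partial_x (partial_t I z) t x"
    by (rule partial_commute[OF z t])
  also have "\<dots> = partial_x (\<lambda>t x. f t x * p t x) t x"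
    by (intro partial_x_cong motion t)
  also have "\<dots> = f t x * partial_x p t x + partial_x f t x * p t x"
    by (intro partial_x_mult smooth_intros z f t)
  finally show ?thesis .
qed

text \<open>
Since \<open>q\<close> is the logarithmic derivative of \<open>p = z'\<close>, and \<open>p\<^sub>t / p = f q + f'\<close> by the previous
lemma, one expects \<open>q\<^sub>t = (f q + f')'\<close>. The logarithm itself is avoided by differentiating
\<open>q p = p'\<close> in time.
\<close>

lemma partial_t_log_deriv:
  assumes t: "t \<in> I"
  shows "partial_t I q t x
    = f t x * partial_x q t x + partial_x f t x * q t x + partial_x (partial_x f) t x"
proof -
  note sm = smooth_log_deriv smooth_intros z f
  have "q t x * partial_t I p t x + partial_t I q t x * p t x = partial_t I (\<lambda>t x. q t x * p t x) t x"
    by (intro partial_t_mult[symmetric] sm t)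
  also have "\<dots> = partial_t I (partial_x p) t x"
    by (intro partial_t_cong t log_deriv_mult)
  also have "\<dots> = partial_x (partial_t I p) t x"
    by (intro partial_commute sm t)
  also have "\<dots> = partial_x (\<lambda>t x. f t x * partial_x p t x + partial_x f t x * p t x) t x"
    by (intro partial_x_cong partial_t_deriv t)
  also have "\<dots> = partial_x (\<lambda>t x. f t x * partial_x p t x) t x + partial_x (\<lambda>t x. partial_x f t x * p t x) t x"
    by (intro partial_x_add sm t)
  also have "partial_x (\<lambda>t x. f t x * partial_x p t x) t x
      = f t x * partial_x (partial_x p) t x + partial_x f t x * partial_x p t x"
    by (intro partial_x_mult sm t)
  also have "partial_x (\<lambda>t x. partial_x f t x * p t x) t x
      = partial_x f t x * partial_x p t x + partial_x (partial_x f) t x * p t x"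
    by (intro partial_x_mult sm t)
  finally show ?thesis
    using immersed[OF t, of x]
    unfolding partial_t_deriv[OF t] partial_x_log_deriv[OF t] log_deriv_mult[OF t, symmetric]
    by (simp add: field_simps power2_eq_square)
qed

text \<open>
The infinitesimal reparametrization formula: \<open>S\<close> transforms like a quadratic differential up to
the term \<open>f'''\<close>. It follows from \<open>S\<^sub>t = q\<^sub>t' - q q\<^sub>t\<close> and the formula for \<open>q\<^sub>t\<close>.
\<close>

lemma schwarzian_evolution:
  assumes t: "t \<in> I"
  shows "partial_t I (schwarzian z) t x
    = f t x * partial_x (schwarzian z) t x + 2 * partial_x f t x * schwarzian z t x
      + partial_x (partial_x (partial_x f)) t x"
proof -
  note sm = smooth_log_deriv smooth_intros z f
  have "partial_x (partial_t I q) t x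
    = partial_x (\<lambda>t x. f t x * partial_x q t x + partial_x f t x * q t x + partial_x (partial_x f) t x) t x"
    by (intro partial_x_cong partial_t_log_deriv t)
  also have "\<dots> = partial_x (\<lambda>t x. f t x * partial_x q t x) t x + partial_x (\<lambda>t x. partial_x f t x * q t x) t x
      + partial_x (partial_x (partial_x f)) t x"
    by (subst partial_x_add, (intro sm t)+, subst partial_x_add, (intro sm t)+, rule refl)
  also have "partial_x (\<lambda>t x. f t x * partial_x q t x) t x
      = f t x * partial_x (partial_x q) t x + partial_x f t x * partial_x q t x"
    by (intro partial_x_mult sm t)
  also have "partial_x (\<lambda>t x. partial_x f t x * q t x) t x
      = partial_x f t x * partial_x q t x + partial_x (partial_x f) t x * q t x"
    by (intro partial_x_mult sm t)
  finally show ?thesis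
    unfolding schwarzian_deriv[OF t] partial_t_log_deriv[OF t]
    by (simp add: schwarzian_def field_simps power2_eq_square)
qed

end

end

end

section \<open>Affine coordinates on the light cone\<close>

lemma ipJ_components: "ipJ u v = u $ 1 * v $ 1 + u $ 2 * v $ 2 - u $ 0 * v $ 3 - u $ 3 * v $ 0"
proof -
  \<comment> \<open>the general sum formula runs over the indices 1 to 4, and the last one is the index 0\<close>
  have four: "(4::4) = 0" by simp
  show ?thesis
    by (simp add: ipJ_def J_def inner_vec_def matrix_vector_mult_def sum_4 four algebra_simps)
qed

lemma det3_components:
  "det3 a b c = a $ 1 * (b $ 2 * c $ 3 - b $ 3 * c $ 2) - a $ 2 * (b $ 1 * c $ 3 - b $ 3 * c $ 1)
     + a $ 3 * (b $ 1 * c $ 2 - b $ 2 * c $ 1)"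
  by (simp add: det3_def loc_def det_3 algebra_simps)

lemma matrix_inv_rotation:
  fixes c s :: real
  assumes "c\<^sup>2 + s\<^sup>2 = 1"
  shows "matrix_inv (vector [vector [c, s], vector [- s, c]] :: real^2^2) = vector [vector [c, - s], vector [s, c]]"
    (is "matrix_inv ?A = ?B")
proof -
  have AB: "?A ** ?B = mat 1" and BA: "?B ** ?A = mat 1"
    using assms by (simp_all add: matrix_matrix_mult_def mat_def vec_eq_iff forall_2 sum_2 power2_eq_square add.commute)
  have "?A ** matrix_inv ?A = mat 1 \<and> matrix_inv ?A ** ?A = mat 1"
    unfolding matrix_inv_def by (rule someI[of _ ?B]) (use AB BA in auto)
  then have "matrix_inv ?A = matrix_inv ?A ** (?A ** ?B)"
    using AB by (simp add: matrix_mul_rid)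
  also have "\<dots> = ?B"
    using \<open>?A ** matrix_inv ?A = mat 1 \<and> matrix_inv ?A ** ?A = mat 1\<close>
    by (simp add: matrix_mul_assoc matrix_mul_lid)
  finally show ?thesis .
qed

lemma matrix_vector_mult_3:
  fixes v :: "real^3"
  shows "(vector [vector [a, b, c], vector [d, e, f], vector [g, h, i]] :: real^3^3) *v v
    = vector [a * v $ 1 + b * v $ 2 + c * v $ 3, d * v $ 1 + e * v $ 2 + f * v $ 3, g * v $ 1 + h * v $ 2 + i * v $ 3]"
  by (simp add: matrix_vector_mult_def vec_eq_iff forall_3 sum_3)

locale cone_family = time_interval I for I :: "real set" +
  fixes u :: "real \<Rightarrow> real \<Rightarrow> real^4"
  assumes smooth: "smooth_family I u"
    and cone: "\<And>t x. t \<in> I \<Longrightarrow> u t x \<in> upper_light_cone"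
    and non_radial: "\<And>t. t \<in> I \<Longrightarrow> star_shaped (u t)"
begin

definition r :: "real \<Rightarrow> real \<Rightarrow> real" where
  "r t x = u t x $ 3"

definition z :: "real \<Rightarrow> real \<Rightarrow> complex" where
  "z t x = Complex (u t x $ 1 / u t x $ 3) (u t x $ 2 / u t x $ 3)"

abbreviation "z1 \<equiv> partial_x z"
abbreviation "z2 \<equiv> partial_x z1"
abbreviation "z3 \<equiv> partial_x z2"
abbreviation "r1 \<equiv> partial_x r"
abbreviation "r2 \<equiv> partial_x r1"
abbreviation "r3 \<equiv> partial_x r2"

lemma r_pos: "t \<in> I \<Longrightarrow> r t x > 0"
  using cone by (auto simp: r_def upper_light_cone_def)

lemma smooth_r [smooth_intros]: "smooth_family I r"
  unfolding r_def[abs_def] by (rule smooth_linear[OF bounded_linear_vec_nth smooth])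

lemma smooth_z [smooth_intros]: "smooth_family I z"
proof -
  have "smooth_family I (\<lambda>t x. (complex_of_real (u t x $ 1) + \<i> * complex_of_real (u t x $ 2)) / complex_of_real (u t x $ 3))"
  proof (rule smooth_divide)
    have c: "bounded_linear (\<lambda>v::real^4. complex_of_real (v $ i))" for i
      using bounded_linear_compose[OF bounded_linear_of_real bounded_linear_vec_nth] .
    show "smooth_family I (\<lambda>t x. complex_of_real (u t x $ 1) + \<i> * complex_of_real (u t x $ 2))"
      using smooth_linear[OF c smooth]
        smooth_linear[OF bounded_linear_compose[OF bounded_linear_mult_right c] smooth]
      by (intro smooth_add)
    show "smooth_family I (\<lambda>t x. complex_of_real (u t x $ 3))"
      by (rule smooth_linear[OF c smooth])
    show "complex_of_real (u t x $ 3) \<noteq> 0" if "t \<in> I" for t x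
      using r_pos[OF that, of x] by (simp add: r_def)
  qed
  then show ?thesis
    by (rule smooth_cong) (simp add: z_def complex_eq_iff)
qed

text \<open>
The last equation is that of the cone; the others merely express \<open>u\<close> by \<open>r\<close> and \<open>z\<close>. Working with
this product form, rather than with quotients of the components of \<open>u\<close>, makes all expressions
below polynomials in the derivatives of \<open>r\<close> and \<open>z\<close>.
\<close>

lemma u_components:
  assumes "t \<in> I"
  shows "u t x $ 1 = r t x * Re (z t x)" "u t x $ 2 = r t x * Im (z t x)" "u t x $ 3 = r t x"
    "u t x $ 0 = r t x * ((Re (z t x))\<^sup>2 + (Im (z t x))\<^sup>2) / 2"
proof -
  have pos: "r t x > 0" by (rule r_pos[OF assms])
  then show 1: "u t x $ 1 = r t x * Re (z t x)" "u t x $ 2 = r t x * Im (z t x)" "u t x $ 3 = r t x"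
    by (simp_all add: r_def z_def)
  have "(u t x $ 1)\<^sup>2 + (u t x $ 2)\<^sup>2 = 2 * (u t x $ 0 * u t x $ 3)"
    using cone[OF assms, of x]
    by (simp add: upper_light_cone_def light_cone_def ipJ_components power2_eq_square)
  then have "r t x * (u t x $ 0) = r t x * (r t x * ((Re (z t x))\<^sup>2 + (Im (z t x))\<^sup>2) / 2)"
    unfolding 1 by (simp add: algebra_simps power2_eq_square)
  then show "u t x $ 0 = r t x * ((Re (z t x))\<^sup>2 + (Im (z t x))\<^sup>2) / 2"
    using pos by simp
qed

lemma u1_components:
  assumes t: "t \<in> I"
  shows "partial_x u t x $ 1 = r1 t x * Re (z t x) + r t x * Re (z1 t x)"
    "partial_x u t x $ 2 = r1 t x * Im (z t x) + r t x * Im (z1 t x)"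
    "partial_x u t x $ 3 = r1 t x"
    "partial_x u t x $ 0 = r1 t x * ((Re (z t x))\<^sup>2 + (Im (z t x))\<^sup>2) / 2
       + r t x * (Re (z t x) * Re (z1 t x) + Im (z t x) * Im (z1 t x))"
  by (rule DERIV_unique[OF real_derivs(4)[OF t smooth]], unfold u_components[OF t],
      (auto intro!: derivative_eq_intros real_derivs[OF t] smooth_deriv_x[OF _ t] smooth_intros
        simp: field_simps power2_eq_square)[1])+

lemma u2_components:
  assumes t: "t \<in> I"
  shows "partial_x (partial_x u) t x $ 1 = r2 t x * Re (z t x) + 2 * r1 t x * Re (z1 t x) + r t x * Re (z2 t x)"
    "partial_x (partial_x u) t x $ 2 = r2 t x * Im (z t x) + 2 * r1 t x * Im (z1 t x) + r t x * Im (z2 t x)"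
    "partial_x (partial_x u) t x $ 3 = r2 t x"
    "partial_x (partial_x u) t x $ 0 = r2 t x * ((Re (z t x))\<^sup>2 + (Im (z t x))\<^sup>2) / 2
       + 2 * r1 t x * (Re (z t x) * Re (z1 t x) + Im (z t x) * Im (z1 t x))
       + r t x * ((Re (z1 t x))\<^sup>2 + (Im (z1 t x))\<^sup>2 + Re (z t x) * Re (z2 t x) + Im (z t x) * Im (z2 t x))"
  by (rule DERIV_unique[OF real_derivs(4)[OF t smooth_partial_x[OF smooth]]], unfold u1_components[OF t],
      (auto intro!: derivative_eq_intros real_derivs[OF t] smooth_deriv_x[OF _ t] smooth_intros
        simp: field_simps power2_eq_square)[1])+

lemma u3_components:
  assumes t: "t \<in> I"
  shows "partial_x (partial_x (partial_x u)) t x $ 1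
       = r3 t x * Re (z t x) + 3 * r2 t x * Re (z1 t x) + 3 * r1 t x * Re (z2 t x) + r t x * Re (z3 t x)"
    "partial_x (partial_x (partial_x u)) t x $ 2
       = r3 t x * Im (z t x) + 3 * r2 t x * Im (z1 t x) + 3 * r1 t x * Im (z2 t x) + r t x * Im (z3 t x)"
    "partial_x (partial_x (partial_x u)) t x $ 3 = r3 t x"
  by (rule DERIV_unique[OF real_derivs(4)[OF t smooth_partial_x[OF smooth_partial_x[OF smooth]]]], unfold u2_components[OF t],
      (auto intro!: derivative_eq_intros real_derivs[OF t] smooth_deriv_x[OF _ t] smooth_intros
        simp: field_simps power2_eq_square)[1])+

lemma dx_eq:
  "dx (u t) = partial_x u t" "(dx ^^ 2) (u t) = partial_x (partial_x u) t"
  "(dx ^^ 3) (u t) = partial_x (partial_x (partial_x u)) t"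
  by (simp_all add: dx_def partial_x_def[abs_def] eval_nat_numeral)

definition k0 :: "real \<Rightarrow> real \<Rightarrow> real" where
  "k0 t x = normJ (dx (u t) x)"

definition speed2 :: "real \<Rightarrow> real \<Rightarrow> real" where
  "speed2 t x = (Re (z1 t x))\<^sup>2 + (Im (z1 t x))\<^sup>2"

definition cross12 :: "real \<Rightarrow> real \<Rightarrow> real" where
  "cross12 t x = Re (z1 t x) * Im (z2 t x) - Im (z1 t x) * Re (z2 t x)"

definition dot12 :: "real \<Rightarrow> real \<Rightarrow> real" where
  "dot12 t x = Re (z1 t x) * Re (z2 t x) + Im (z1 t x) * Im (z2 t x)"

text \<open>
All products below are invariant under translations of \<open>z\<close>, which are induced by linear
isometries of the form that act on the last three coordinates with determinant 1. This is why
\<open>z\<close> itself drops out, leaving only its derivatives.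
\<close>

lemma ipJ_u1_u1: "t \<in> I \<Longrightarrow> ipJ (dx (u t) x) (dx (u t) x) = (r t x)\<^sup>2 * speed2 t x"
  by (simp add: dx_eq ipJ_components u1_components speed2_def algebra_simps power2_eq_square)

lemma ipJ_u1_u2:
  "t \<in> I \<Longrightarrow> ipJ (dx (u t) x) ((dx ^^ 2) (u t) x) = r t x * (r1 t x * speed2 t x + r t x * dot12 t x)"
  unfolding dx_eq ipJ_components u1_components u2_components speed2_def dot12_def
  by (simp add: field_simps power2_eq_square)

lemma ipJ_u2_u2:
  "t \<in> I \<Longrightarrow> ipJ ((dx ^^ 2) (u t) x) ((dx ^^ 2) (u t) x)
    = - 2 * r t x * r2 t x * speed2 t x + 4 * (r1 t x)\<^sup>2 * speed2 t x + 4 * r t x * r1 t x * dot12 t x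
      + (r t x)\<^sup>2 * ((Re (z2 t x))\<^sup>2 + (Im (z2 t x))\<^sup>2)"
  unfolding dx_eq ipJ_components u2_components speed2_def dot12_def
  by (simp add: field_simps power2_eq_square)

lemma det3_u2: "t \<in> I \<Longrightarrow> det3 (u t x) (dx (u t) x) ((dx ^^ 2) (u t) x) = (r t x)^3 * cross12 t x"
  unfolding dx_eq det3_components u_components u1_components u2_components cross12_def
  by (simp add: field_simps power2_eq_square power3_eq_cube)

lemma det3_u3:
  "t \<in> I \<Longrightarrow> det3 (u t x) (dx (u t) x) ((dx ^^ 3) (u t) x)
    = (r t x)\<^sup>2 * (3 * r1 t x * cross12 t x + r t x * (Re (z1 t x) * Im (z3 t x) - Im (z1 t x) * Re (z3 t x)))"
  unfolding dx_eq det3_components u_components u1_components u3_components cross12_def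
  by (simp add: field_simps power2_eq_square power3_eq_cube)

lemma speed2_eq: "speed2 t x = (cmod (z1 t x))\<^sup>2"
  by (simp add: speed2_def cmod_power2)

lemma k0_eq: "t \<in> I \<Longrightarrow> k0 t x = r t x * cmod (z1 t x)"
  using r_pos[of t x] by (simp add: k0_def normJ_def ipJ_u1_u1 speed2_eq real_sqrt_mult)

lemma k0_pos: "t \<in> I \<Longrightarrow> k0 t x > 0"
  using non_radial[of t] k0_eq[of t x] r_pos[of t x]
  by (auto simp: k0_def star_shaped_def zero_less_mult_iff less_le)

lemma k0_square: "t \<in> I \<Longrightarrow> (k0 t x)\<^sup>2 = (r t x)\<^sup>2 * speed2 t x"
  by (simp add: k0_eq speed2_eq power_mult_distrib)

lemma speed2_pos: "t \<in> I \<Longrightarrow> speed2 t x > 0"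
  using k0_pos[of t x] k0_eq[of t x] by (auto simp: speed2_eq)

lemma z1_nonzero: "t \<in> I \<Longrightarrow> z1 t x \<noteq> 0"
  using speed2_pos[of t x] by (auto simp: speed2_eq)

lemma k0_sqrt: "t \<in> I \<Longrightarrow> k0 t x = sqrt ((r t x)\<^sup>2 * speed2 t x)"
  using k0_square[of t x] k0_pos[of t x] by (metis less_imp_le real_sqrt_unique)

lemma k0_deriv_x:
  assumes t: "t \<in> I"
  shows "(k0 t has_real_derivative (r t x * r1 t x * speed2 t x + (r t x)\<^sup>2 * dot12 t x) / k0 t x) (at x)"
proof -
  have pos: "(r t x)\<^sup>2 * speed2 t x > 0"
    using r_pos[OF t, of x] speed2_pos[OF t, of x] by simp
  have "((\<lambda>x. (r t x)\<^sup>2 * speed2 t x) has_real_derivative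
      2 * (r t x * r1 t x * speed2 t x + (r t x)\<^sup>2 * dot12 t x)) (at x)"
    unfolding speed2_def dot12_def
    by (auto intro!: derivative_eq_intros real_derivs[OF t] smooth_deriv_x[OF _ t] smooth_intros
        simp: algebra_simps power2_eq_square)
  from DERIV_chain'[OF this DERIV_real_sqrt[OF pos]]
  have "((\<lambda>x. sqrt ((r t x)\<^sup>2 * speed2 t x)) has_real_derivative
      (r t x * r1 t x * speed2 t x + (r t x)\<^sup>2 * dot12 t x) / k0 t x) (at x)"
    unfolding k0_sqrt[OF t, symmetric]
    by (rule DERIV_cong) (use k0_pos[OF t, of x] in \<open>simp add: field_simps\<close>)
  then show ?thesis
    unfolding k0_sqrt[OF t, symmetric] .
qed

text \<open>
Differentiating the unit speed condition \<open>r\<^sup>2 \<bar>z'\<bar>\<^sup>2 = 1\<close> once and twice expresses \<open>r'\<close> and \<open>r''\<close> by \<open>r\<close>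
and the derivatives of \<open>z\<close>. After this substitution both sides are polynomials in \<open>r\<close> and
in the products of \<open>z', z'', z'''\<close>, and they agree modulo \<open>r\<^sup>2 \<bar>z'\<bar>\<^sup>2 = 1\<close> and the Lagrange identity
for \<open>z'\<close> and \<open>z''\<close>.
\<close>

lemma curvatures_schwarzian:
  assumes t: "t \<in> I" and arc: "\<And>x. k0 t x = 1"
  shows "k1 (u t) x = - Re (schwarzian z t x)" and "k2 (u t) x = Im (schwarzian z t x)"
proof -
  define V E D where "V = (Re (z2 t x))\<^sup>2 + (Im (z2 t x))\<^sup>2"
    and "E = Re (z1 t x) * Re (z3 t x) + Im (z1 t x) * Im (z3 t x)"
    and "D = Re (z1 t x) * Im (z3 t x) - Im (z1 t x) * Re (z3 t x)"
  define R g w P' where "R = r t x" and "g = dot12 t x" and "w = cross12 t x" and "P' = speed2 t x"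
  have R: "R > 0" by (simp add: R_def r_pos[OF t])
  have norm: "(r t y)\<^sup>2 * speed2 t y = 1" for y
    using k0_square[OF t, of y] arc by simp
  have r1: "r1 t y = - ((r t y)^3 * dot12 t y)" for y
  proof -
    have "k0 t = (\<lambda>x. 1)" using arc by auto
    then have "(r t y * r1 t y * speed2 t y + (r t y)\<^sup>2 * dot12 t y) / k0 t y = 0"
      using DERIV_unique[OF k0_deriv_x[OF t, of y]] by simp
    then have "r1 t y * ((r t y)\<^sup>2 * speed2 t y) = - ((r t y)^3 * dot12 t y)"
      using arc[of y] r_pos[OF t, of y] by (simp add: power2_eq_square power3_eq_cube) algebra
    then show ?thesis by (simp add: norm)
  qed
  have r2: "r2 t x = 3 * R^5 * g\<^sup>2 - R^3 * (V + E)"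
  proof -
    have "r1 t = (\<lambda>y. - ((r t y)^3 * dot12 t y))"
      using r1 by auto
    moreover have "(r1 t has_real_derivative r2 t x) (at x)"
      by (intro real_derivs(1)[OF t] smooth_intros)
    moreover have "((\<lambda>y. - ((r t y)^3 * dot12 t y)) has_real_derivative
        - (3 * R\<^sup>2 * r1 t x * g + R^3 * (V + E))) (at x)"
      unfolding R_def g_def V_def E_def dot12_def
      by (auto intro!: derivative_eq_intros real_derivs[OF t] smooth_deriv_x[OF _ t] smooth_intros
          simp: algebra_simps power2_eq_square power3_eq_cube)
    ultimately have "r2 t x = - (3 * R\<^sup>2 * r1 t x * g + R^3 * (V + E))"
      using DERIV_unique by metis
    then show ?thesis
      unfolding r1 by (simp add: R_def g_def algebra_simps flip: power_add) (simp add: eval_nat_numeral)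
  qed
  have lagrange: "g\<^sup>2 + w\<^sup>2 = P' * V"
    by (simp add: g_def w_def P'_def V_def dot12_def cross12_def speed2_def algebra_simps power2_eq_square)
  have RP: "R\<^sup>2 * P' = 1"
    by (simp add: R_def P'_def norm)
  \<comment> \<open>by unit speed this is the inverse of \<open>z1 t x\<close>, so that the Schwarzian becomes a polynomial\<close>
  define c where "c = complex_of_real (R\<^sup>2) * cnj (z1 t x)"
  have "z1 t x * c = 1"
    using RP by (simp add: c_def complex_eq_iff P'_def speed2_def power2_eq_square algebra_simps)
  then have inv: "y / z1 t x = y * c" for y
    using z1_nonzero[OF t, of x] by (simp add: field_simps)
  have S: "schwarzian z t x = z3 t x * c - 3 / 2 * (z2 t x * c)\<^sup>2"
    unfolding inv[symmetric] by (rule schwarzian_eq[OF smooth_z _ t]) (rule z1_nonzero)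
  have z3c: "z3 t x * c = R\<^sup>2 * Complex E D" and z2c: "z2 t x * c = R\<^sup>2 * Complex g w"
    by (simp_all add: c_def complex_eq_iff E_def D_def g_def w_def dot12_def cross12_def algebra_simps)
  have ReS: "Re (schwarzian z t x) = R\<^sup>2 * E - 3 / 2 * (R^4 * (g\<^sup>2 - w\<^sup>2))"
    and ImS: "Im (schwarzian z t x) = R\<^sup>2 * D - 3 * R^4 * g * w"
    unfolding S z3c z2c by (simp_all add: power2_eq_square eval_nat_numeral field_simps)
  have ip12: "ipJ (dx (u t) x) ((dx ^^ 2) (u t) x) = 0"
    unfolding ipJ_u1_u2[OF t] r1 using norm[of x] R
    by (simp add: R_def) algebra
  have n1: "normJ (dx (u t) x) = 1"
    using arc by (simp add: k0_def)
  have "ipJ ((dx ^^ 2) (u t) x) ((dx ^^ 2) (u t) x)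
     = - 2 * R * (3 * R^5 * g\<^sup>2 - R^3 * (V + E)) * P' + 4 * (R^3 * g)\<^sup>2 * P' - 4 * R * (R^3 * g) * g + R\<^sup>2 * V"
    unfolding ipJ_u2_u2[OF t] r2 r1 by (simp add: R_def g_def P'_def V_def)
  also have "\<dots> = - 6 * R^4 * g\<^sup>2 + 2 * R\<^sup>2 * (V + E) + R\<^sup>2 * V"
    using RP by algebra
  also have "\<dots> = 2 * (R\<^sup>2 * E - 3 / 2 * (R^4 * (g\<^sup>2 - w\<^sup>2)))"
  proof -
    have "R^4 * (g\<^sup>2 + w\<^sup>2) = R\<^sup>2 * V"
      using lagrange RP by algebra
    then show ?thesis by (simp add: algebra_simps)
  qed
  finally show "k1 (u t) x = - Re (schwarzian z t x)"
    unfolding k1_def n1 ip12 ReS by simp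
  have "k2 (u t) x = R\<^sup>2 * (3 * (- (R^3 * g)) * w + R * D) / R"
    unfolding k2_def n1 ip12 det3_u3[OF t] r1 u_components[OF t]
    by (simp add: R_def g_def w_def D_def)
  also have "R\<^sup>2 * (3 * (- (R^3 * g)) * w + R * D) = R * (R\<^sup>2 * D - 3 * R^4 * g * w)"
    by algebra
  finally show "k2 (u t) x = Im (schwarzian z t x)"
    unfolding ImS using R by simp
qed

end

section \<open>The flow and the preservation of arc length\<close>

text \<open>
The integrating factor \<open>exp (- \<integral> c)\<close> turns the solution \<open>y\<close> into a constant, which vanishes at
\<open>s0\<close>.
\<close>

lemma linear_ode_zero_unique:
  fixes y c :: "real \<Rightarrow> real"
  assumes "a \<le> b" and c: "continuous_on {a..b} c"
    and y: "\<And>s. s \<in> {a..b} \<Longrightarrow> (y has_real_derivative c s * y s) (at s within {a..b})"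
    and s0: "s0 \<in> {a..b}" "y s0 = 0" and s: "s \<in> {a..b}"
  shows "y s = 0"
proof -
  define C where "C s = integral {a..s} c" for s
  have C: "(C has_real_derivative c s) (at s within {a..b})" if "s \<in> {a..b}" for s
    unfolding has_real_derivative_iff_has_vector_derivative C_def
    using integral_has_vector_derivative[OF c that] .
  have "((\<lambda>s. y s * exp (- C s)) has_real_derivative 0) (at s within {a..b})" if "s \<in> {a..b}" for s
    using that by (auto intro!: derivative_eq_intros C y simp: algebra_simps)
  then obtain d where d: "\<And>s. s \<in> {a..b} \<Longrightarrow> y s * exp (- C s) = d"
    using has_field_derivative_zero_constant[of "{a..b}" "\<lambda>s. y s * exp (- C s)"] by auto
  from d[OF s0(1)] d[OF s] s0(2) show ?thesis by simp
qed

locale cone_flow = cone_family +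
  assumes flow: "\<And>t x. t \<in> I \<Longrightarrow>
      ((\<lambda>s. loc (u s x)) has_vector_derivative
        (flow_matrix (u t) x *v vector [k1 (u t) x, k2 (u t) x, - dx (k1 (u t)) x]))
      (at t within I)"
begin

text \<open>
The matrix represents multiplication by the conjugate of \<open>z' / \<bar>z'\<bar>\<close>; in particular it is a
rotation, whose inverse is its transpose.
\<close>

lemma frame_A_eq:
  assumes t: "t \<in> I"
  shows "frame_A (u t) x
    = vector [vector [Re (z1 t x) / cmod (z1 t x), Im (z1 t x) / cmod (z1 t x)],
              vector [- (Im (z1 t x) / cmod (z1 t x)), Re (z1 t x) / cmod (z1 t x)]]"
proof -
  have "r t x \<noteq> 0" "cmod (z1 t x) \<noteq> 0"
    using r_pos[OF t, of x] z1_nonzero[OF t, of x] by auto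
  then show ?thesis
    unfolding frame_A_def Let_def k0_def[symmetric] k0_eq[OF t] vec_eq_iff
    by (simp add: forall_2 u_components[OF t] dx_eq u1_components[OF t] divide_simps)
      (simp add: algebra_simps)
qed

lemma frame_xi_eq:
  assumes t: "t \<in> I"
  shows "frame_xi (u t) x = vector [- (r1 t x / (r t x * k0 t x)), - ((r t x)\<^sup>2 * cross12 t x / (k0 t x) ^ 3)]"
proof -
  have "r t x \<noteq> 0" "k0 t x \<noteq> 0"
    using r_pos[OF t, of x] k0_pos[OF t, of x] by auto
  then show ?thesis
    unfolding frame_xi_def det3_u2[OF t] k0_def[symmetric]
    by (simp add: vec_eq_iff forall_2 u_components[OF t] dx_eq u1_components[OF t])
      (simp add: power2_eq_square power3_eq_cube)
qed

text \<open>
The first two components are those of \<open>z' (k\<^sub>1 + \<i> k\<^sub>2) / \<bar>z'\<bar>\<close>, up to a multiple of \<open>u\<close> itself. The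
radial coefficient \<open>- M\<close> collects \<open>- \<xi>\<^sup>T (k\<^sub>1, k\<^sub>2)\<close> and the third entry \<open>- k\<^sub>1'\<close> of the vector to which
the flow matrix is applied.
\<close>

lemma flow_components:
  fixes t x
  defines "M \<equiv> - (r1 t x / (r t x * k0 t x)) * k1 (u t) x - ((r t x)\<^sup>2 * cross12 t x / (k0 t x) ^ 3) * k2 (u t) x
      + dx (k1 (u t)) x"
  assumes t: "t \<in> I"
  shows "partial_t I u t x $ 1
      = (Re (z1 t x) * k1 (u t) x - Im (z1 t x) * k2 (u t) x) / cmod (z1 t x) - u t x $ 1 * M"
    and "partial_t I u t x $ 2
      = (Im (z1 t x) * k1 (u t) x + Re (z1 t x) * k2 (u t) x) / cmod (z1 t x) - u t x $ 2 * M"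
    and "partial_t I u t x $ 3 = - u t x $ 3 * M"
proof -
  have nz: "cmod (z1 t x) \<noteq> 0"
    using z1_nonzero[OF t, of x] by simp
  have inv: "matrix_inv (frame_A (u t) x)
    = vector [vector [Re (z1 t x) / cmod (z1 t x), - (Im (z1 t x) / cmod (z1 t x))],
              vector [Im (z1 t x) / cmod (z1 t x), Re (z1 t x) / cmod (z1 t x)]]"
    unfolding frame_A_eq[OF t]
    by (rule matrix_inv_rotation) (use nz in \<open>simp add: power_divide flip: add_divide_distrib cmod_power2\<close>)
  let ?F = "flow_matrix (u t) x *v vector [k1 (u t) x, k2 (u t) x, - dx (k1 (u t)) x]"
  have "?F $ 1 = (Re (z1 t x) * k1 (u t) x - Im (z1 t x) * k2 (u t) x) / cmod (z1 t x) - u t x $ 1 * M"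
    "?F $ 2 = (Im (z1 t x) * k1 (u t) x + Re (z1 t x) * k2 (u t) x) / cmod (z1 t x) - u t x $ 2 * M"
    "?F $ 3 = - u t x $ 3 * M"
    unfolding flow_matrix_def Let_def matrix_vector_mult_3 inv frame_xi_eq[OF t]
    by (simp_all add: hat_def M_def algebra_simps diff_divide_distrib add_divide_distrib)
  moreover have "partial_t I u t x $ i = ?F $ j" if "\<And>v. loc v $ j = v $ i" for i j
  proof -
    have "((\<lambda>s. u s x $ i) has_vector_derivative ?F $ j) (at t within I)"
      using bounded_linear.has_vector_derivative[OF bounded_linear_vec_nth[of j] flow[OF t, of x]]
      by (simp add: that)
    with real_derivs(8)[OF t smooth] show ?thesis
      unfolding has_real_derivative_iff_has_vector_derivative
      using vector_derivative_unique_within[OF at_within_neq_bot[OF t]] by blast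
  qed
  from this[of 1 1] this[of 2 2] this[of 3 3]
  have "partial_t I u t x $ 1 = ?F $ 1" "partial_t I u t x $ 2 = ?F $ 2" "partial_t I u t x $ 3 = ?F $ 3"
    by (auto simp: loc_def)
  ultimately show "partial_t I u t x $ 1
      = (Re (z1 t x) * k1 (u t) x - Im (z1 t x) * k2 (u t) x) / cmod (z1 t x) - u t x $ 1 * M"
    and "partial_t I u t x $ 2
      = (Im (z1 t x) * k1 (u t) x + Re (z1 t x) * k2 (u t) x) / cmod (z1 t x) - u t x $ 2 * M"
    and "partial_t I u t x $ 3 = - u t x $ 3 * M"
    by simp_all
qed

text \<open>
The velocity of \<open>z\<close> measured in units of its tangent vector. It is manifestly a smooth family,
whereas \<open>k1\<close> and \<open>k2\<close> are given by formulas involving roots; the differentiability of the latter is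
obtained from \<open>curvatures_eq\<close>.
\<close>

definition vel :: "real \<Rightarrow> real \<Rightarrow> complex" where
  "vel t x = partial_t I z t x / z1 t x"

lemma smooth_vel [smooth_intros]: "smooth_family I vel"
  unfolding vel_def[abs_def] by (intro smooth_divide smooth_intros z1_nonzero)

lemma partial_t_r:
  assumes t: "t \<in> I"
  shows "partial_t I r t x = r1 t x * k1 (u t) x / k0 t x + (r t x)^3 * cross12 t x * k2 (u t) x / (k0 t x)^3
    - r t x * dx (k1 (u t)) x"
proof -
  have "r t x \<noteq> 0" using r_pos[OF t, of x] by simp
  have "partial_t I r t x = partial_t I u t x $ 3"
    unfolding r_def[abs_def] by (rule partial_t_linear[OF bounded_linear_vec_nth smooth t])
  also have "\<dots> = r1 t x * k1 (u t) x / k0 t x + (r t x)^3 * cross12 t x * k2 (u t) x / (k0 t x)^3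
    - r t x * dx (k1 (u t)) x"
    using \<open>r t x \<noteq> 0\<close>
    by (simp add: flow_components(3)[OF t] u_components[OF t] algebra_simps power2_eq_square power3_eq_cube)
  finally show ?thesis .
qed

text \<open>
The radial multiple of \<open>u\<close> in the flow changes \<open>r\<close> but not the ratios of the components.
Only the rotated vector \<open>(k\<^sub>1, k\<^sub>2)\<close> is seen by \<open>z\<close>, whatever the coefficient \<open>M\<close> is.
\<close>

lemma curvatures_eq:
  assumes t: "t \<in> I"
  shows "Complex (k1 (u t) x) (k2 (u t) x) = k0 t x * vel t x"
proof -
  let ?k = "k1 (u t) x" and ?l = "k2 (u t) x" and ?n = "cmod (z1 t x)"
  have nz: "r t x \<noteq> 0" "?n \<noteq> 0" "z1 t x \<noteq> 0"
    using r_pos[OF t, of x] z1_nonzero[OF t, of x] by auto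
  obtain M where M: "partial_t I u t x $ 1 = (Re (z1 t x) * ?k - Im (z1 t x) * ?l) / ?n - u t x $ 1 * M"
    "partial_t I u t x $ 2 = (Im (z1 t x) * ?k + Re (z1 t x) * ?l) / ?n - u t x $ 2 * M"
    "partial_t I u t x $ 3 = - u t x $ 3 * M"
    using flow_components[OF t] by blast
  have r: "partial_t I r t x = partial_t I u t x $ 3"
    unfolding r_def[abs_def] by (rule partial_t_linear[OF bounded_linear_vec_nth smooth t])
  have Re: "partial_t I (\<lambda>t x. u t x $ 1) t x = partial_t I (\<lambda>t x. r t x * Re (z t x)) t x"
    and Im: "partial_t I (\<lambda>t x. u t x $ 2) t x = partial_t I (\<lambda>t x. r t x * Im (z t x)) t x"
    by (rule partial_t_cong[OF t], rule u_components, assumption)+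
  have sRe: "smooth_family I (\<lambda>t x. Re (z t x))" and sIm: "smooth_family I (\<lambda>t x. Im (z t x))"
    by (rule smooth_linear[OF bounded_linear_Re smooth_z] smooth_linear[OF bounded_linear_Im smooth_z])+
  from Re Im have
    "partial_t I u t x $ 1 = r t x * Re (partial_t I z t x) + partial_t I r t x * Re (z t x)"
    "partial_t I u t x $ 2 = r t x * Im (partial_t I z t x) + partial_t I r t x * Im (z t x)"
    unfolding partial_t_mult[OF smooth_r sRe t] partial_t_mult[OF smooth_r sIm t]
      partial_t_linear[OF bounded_linear_vec_nth smooth t]
      partial_t_linear[OF bounded_linear_Re smooth_z t] partial_t_linear[OF bounded_linear_Im smooth_z t]
    by auto
  then have "r t x * Re (partial_t I z t x) = (Re (z1 t x) * ?k - Im (z1 t x) * ?l) / ?n"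
    and "r t x * Im (partial_t I z t x) = (Im (z1 t x) * ?k + Re (z1 t x) * ?l) / ?n"
    unfolding r M unfolding u_components[OF t] by (simp_all add: algebra_simps)
  then have "k0 t x * partial_t I z t x = Complex ?k ?l * z1 t x"
    using nz by (simp add: complex_eq_iff k0_eq[OF t] field_simps)
  then show ?thesis
    using nz by (simp add: vel_def field_simps)
qed

lemma k1_eq: "t \<in> I \<Longrightarrow> k1 (u t) x = k0 t x * Re (vel t x)"
  and k2_eq: "t \<in> I \<Longrightarrow> k2 (u t) x = k0 t x * Im (vel t x)"
  using curvatures_eq[of t x] by (simp_all add: complex_eq_iff)

lemma partial_t_z1:
  assumes t: "t \<in> I"
  shows "partial_t I z1 t x = vel t x * z2 t x + partial_x vel t x * z1 t x"
  by (rule partial_t_deriv[OF smooth_z _ smooth_vel _ t]) (simp_all add: z1_nonzero vel_def)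

lemma k0_deriv_t:
  assumes t: "t \<in> I"
  shows "((\<lambda>s. k0 s x) has_real_derivative
      (r t x * partial_t I r t x * speed2 t x
        + (r t x)\<^sup>2 * (Re (z1 t x) * Re (partial_t I z1 t x) + Im (z1 t x) * Im (partial_t I z1 t x))) / k0 t x)
      (at t within I)" (is "(_ has_real_derivative ?d / _) _")
proof -
  have pos: "(r t x)\<^sup>2 * speed2 t x > 0"
    using r_pos[OF t, of x] speed2_pos[OF t, of x] by simp
  have "((\<lambda>s. (r s x)\<^sup>2 * speed2 s x) has_real_derivative 2 * ?d) (at t within I)"
    unfolding speed2_def
    using real_derivs(5)[OF t smooth_r] real_derivs(6,7)[OF t smooth_partial_x[OF smooth_z]]
    by (auto intro!: DERIV_cong[OF DERIV_mult] DERIV_cong[OF DERIV_add] DERIV_cong[OF DERIV_power]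
        simp: algebra_simps power2_eq_square)
  from DERIV_chain'[OF this DERIV_real_sqrt[OF pos]]
  have "((\<lambda>s. sqrt ((r s x)\<^sup>2 * speed2 s x)) has_real_derivative ?d / k0 t x) (at t within I)"
    unfolding k0_sqrt[OF t, symmetric]
    by (rule DERIV_cong) (use k0_pos[OF t, of x] in \<open>simp add: field_simps\<close>)
  then show ?thesis
    unfolding has_field_derivative_def
    by (rule has_derivative_transform[OF t, rotated]) (rule k0_sqrt)
qed

lemma dx_k1:
  assumes t: "t \<in> I"
  shows "dx (k1 (u t)) x
    = (r t x * r1 t x * speed2 t x + (r t x)\<^sup>2 * dot12 t x) / k0 t x * Re (vel t x) + k0 t x * Re (partial_x vel t x)"
proof -
  have "((\<lambda>x. k0 t x * Re (vel t x)) has_real_derivative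
    (r t x * r1 t x * speed2 t x + (r t x)\<^sup>2 * dot12 t x) / k0 t x * Re (vel t x) + k0 t x * Re (partial_x vel t x)) (at x)"
    by (auto intro!: derivative_eq_intros k0_deriv_x[OF t] smooth_deriv_x[OF _ t] smooth_intros)
  moreover have "k1 (u t) = (\<lambda>x. k0 t x * Re (vel t x))"
    using k1_eq[OF t] by auto
  ultimately show ?thesis
    unfolding dx_def has_real_derivative_iff_has_vector_derivative by (simp add: vector_derivative_at)
qed

text \<open>
In \<open>k\<^sub>0 (k\<^sub>0)\<^sub>t = r r\<^sub>t \<bar>z'\<bar>\<^sup>2 + r\<^sup>2 Re (cnj z' z'\<^sub>t)\<close> the terms with \<open>k\<^sub>2\<close> cancel: this is the purpose of the
component \<open>\<xi>\<^sub>2\<close>. The component \<open>\<xi>\<^sub>1\<close> completes the terms with \<open>k\<^sub>1\<close> to \<open>k\<^sub>0 k\<^sub>1'\<close>, and the third entry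
\<open>- k\<^sub>1'\<close> of the flow vector contributes \<open>- k\<^sub>0\<^sup>2 k\<^sub>1'\<close>, which cancels the former when \<open>k\<^sub>0 = 1\<close>.
\<close>

lemma k0_evolution:
  assumes t: "t \<in> I"
  shows "((\<lambda>s. k0 s x) has_real_derivative dx (k1 (u t)) x * (1 - k0 t x)) (at t within I)"
proof -
  define R R1 k p g w \<kappa> where "R = r t x" and "R1 = r1 t x" and "k = k0 t x" and "p = speed2 t x"
    and "g = dot12 t x" and "w = cross12 t x" and "\<kappa> = dx (k1 (u t)) x"
  note defs = this
  define a b a' b' where "a = Re (vel t x)" and "b = Im (vel t x)" and "a' = Re (partial_x vel t x)" and "b' = Im (partial_x vel t x)"
  note defs' = this
  have pos: "R > 0" "k > 0" "p > 0"
    using r_pos[OF t] k0_pos[OF t] speed2_pos[OF t] by (auto simp: defs)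
  have k: "k\<^sup>2 = R\<^sup>2 * p"
    using k0_square[OF t] by (simp add: defs)
  have "partial_t I r t x = R1 * a + R^3 * w * b / k\<^sup>2 - R * \<kappa>"
    using pos by (simp add: partial_t_r[OF t] k1_eq[OF t] k2_eq[OF t] defs defs' power2_eq_square power3_eq_cube)
  then have rt: "partial_t I r t x * p = R1 * a * p + R * w * b - R * \<kappa> * p"
    unfolding k using pos by (simp add: field_simps power2_eq_square power3_eq_cube)
  have zt: "Re (z1 t x) * Re (partial_t I z1 t x) + Im (z1 t x) * Im (partial_t I z1 t x)
     = a * g - b * w + a' * p"
    by (simp add: partial_t_z1[OF t] defs defs' speed2_def dot12_def cross12_def algebra_simps power2_eq_square)
  have \<kappa>: "\<kappa> * k = (R * R1 * p + R\<^sup>2 * g) * a + k\<^sup>2 * a'"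
    using pos dx_k1[OF t, of x] by (simp add: defs defs' field_simps power2_eq_square)
  have "R * partial_t I r t x * p + R\<^sup>2 * (a * g - b * w + a' * p) = \<kappa> * (1 - k) * k"
  proof -
    have "R * partial_t I r t x * p = R * (R1 * a * p + R * w * b - R * \<kappa> * p)"
      using rt by (simp add: mult.assoc)
    then have "R * partial_t I r t x * p + R\<^sup>2 * (a * g - b * w + a' * p)
      = ((R * R1 * p + R\<^sup>2 * g) * a + (R\<^sup>2 * p) * a') - (R\<^sup>2 * p) * \<kappa>"
      by (simp add: algebra_simps power2_eq_square)
    also have "\<dots> = \<kappa> * k - k\<^sup>2 * \<kappa>"
      unfolding \<kappa> unfolding k ..
    also have "\<dots> = \<kappa> * (1 - k) * k"
      by (simp add: algebra_simps power2_eq_square)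
    finally show ?thesis .
  qed
  then have "(R * partial_t I r t x * p + R\<^sup>2 * (a * g - b * w + a' * p)) / k = \<kappa> * (1 - k)"
    using pos by simp
  with k0_deriv_t[OF t, of x] show ?thesis
    unfolding zt by (simp add: defs)
qed

lemma dx_k1_continuous:
  assumes "S \<subseteq> I"
  shows "continuous_on S (\<lambda>t. dx (k1 (u t)) x)"
proof -
  have sm: "continuous_on S (\<lambda>t. h t x)" if "smooth_family I h" for h :: "real \<Rightarrow> real \<Rightarrow> 'a::real_normed_vector"
    using smooth_continuous_t[OF that assms] .
  have k0: "continuous_on S (\<lambda>t. k0 t x)"
    by (rule continuous_on_eq[OF continuous_on_mult[OF sm[OF smooth_r]
            continuous_on_norm[OF sm[OF smooth_partial_x[OF smooth_z]]]]])
      (use assms k0_eq in auto)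
  have PG: "continuous_on S (\<lambda>t. speed2 t x)" "continuous_on S (\<lambda>t. dot12 t x)"
    unfolding speed2_def dot12_def by (intro continuous_intros sm smooth_intros)+
  have nz: "\<forall>t\<in>S. k0 t x \<noteq> 0"
    using assms k0_pos by (metis less_irrefl subsetD)
  have "continuous_on S (\<lambda>t.
     (r t x * r1 t x * speed2 t x + (r t x)\<^sup>2 * dot12 t x) / k0 t x * Re (vel t x) + k0 t x * Re (partial_x vel t x))"
    by (intro continuous_intros k0 PG nz sm smooth_intros)
  then show ?thesis
    by (rule continuous_on_eq) (use assms dx_k1 in auto)
qed

lemma arc_length_preserved:
  assumes t0: "t0 \<in> I" and arc: "arc_length_parametrized (u t0)" and t: "t \<in> I"
  shows "k0 t x = 1"
proof -
  let ?a = "min t0 t" and ?b = "max t0 t"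
  have sub: "{?a..?b} \<subseteq> I"
    using mem_is_interval_1_I[OF interval t0 t] mem_is_interval_1_I[OF interval t t0] by (auto simp: min_def max_def split: if_splits)
  have "k0 t x - 1 = 0"
  proof (rule linear_ode_zero_unique[of ?a ?b "\<lambda>t. - dx (k1 (u t)) x" "\<lambda>t. k0 t x - 1" t0 t])
    show "continuous_on {?a..?b} (\<lambda>t. - dx (k1 (u t)) x)"
      by (intro continuous_intros dx_k1_continuous sub)
    show "((\<lambda>t. k0 t x - 1) has_real_derivative - dx (k1 (u s)) x * (k0 s x - 1)) (at s within {?a..?b})"
      if "s \<in> {?a..?b}" for s
    proof -
      have "((\<lambda>t. k0 t x - 1) has_real_derivative - dx (k1 (u s)) x * (k0 s x - 1)) (at s within I)"
        using that sub by (auto intro!: derivative_eq_intros k0_evolution simp: algebra_simps)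
      then show ?thesis using sub by (rule DERIV_subset)
    qed
    show "k0 t0 x - 1 = 0"
      using arc by (simp add: arc_length_parametrized_def k0_def)
  qed auto
  then show ?thesis by simp
qed

end

section \<open>The coupled KdV system\<close>

context cone_flow
begin

text \<open>
At unit speed \<open>vel = k\<^sub>1 + \<i> k\<^sub>2 = - cnj S\<close>, so the evolution of the Schwarzian derivative becomes
\<open>S\<^sub>t = - cnj S S' - 2 cnj S' S - cnj S'''\<close>. The conjugations produce the opposite signs of the third
derivatives in the two equations.
\<close>

lemma curvature_evolution:
  assumes arc: "\<And>t x. t \<in> I \<Longrightarrow> k0 t x = 1" and t: "t \<in> I"
  shows "((\<lambda>s. k1 (u s) x) has_real_derivative
      - (dx ^^ 3) (k1 (u t)) x + 3 * k1 (u t) x * dx (k1 (u t)) x + 3 * k2 (u t) x * dx (k2 (u t)) x)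
      (at t within I)"
    and "((\<lambda>s. k2 (u s) x) has_real_derivative
      (dx ^^ 3) (k2 (u t)) x + dx (k1 (u t)) x * k2 (u t) x - k1 (u t) x * dx (k2 (u t)) x)
      (at t within I)"
proof -
  let ?S = "schwarzian z"
  let ?S1 = "partial_x ?S"
  let ?S2 = "partial_x ?S1"
  let ?S3 = "partial_x ?S2"
  have sS: "smooth_family I ?S"
    by (rule smooth_schwarzian[OF smooth_z z1_nonzero])
  note sm = smooth_intros sS
  have k1: "k1 (u s) = (\<lambda>y. - Re (?S s y))" and k2: "k2 (u s) = (\<lambda>y. Im (?S s y))" if "s \<in> I" for s
    using curvatures_schwarzian[OF that arc[OF that]] by auto
  have dRe: "dx (\<lambda>y. - Re (h t y)) = (\<lambda>y. - Re (partial_x h t y))"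
    and dIm: "dx (\<lambda>y. Im (h t y)) = (\<lambda>y. Im (partial_x h t y))" if "smooth_family I h" for h
    using partial_x_linear[OF bounded_linear_minus[OF bounded_linear_Re] that t]
      partial_x_linear[OF bounded_linear_Im that t]
    by (auto simp: dx_def partial_x_def)
  have vel: "vel s y = - cnj (?S s y)" if "s \<in> I" for s y
    using curvatures_eq[OF that, of y] curvatures_schwarzian[OF that arc[OF that], of y] arc[OF that, of y]
    by (simp add: complex_eq_iff)
  have cl: "bounded_linear (\<lambda>c. - cnj c)"
    by (rule bounded_linear_minus[OF bounded_linear_cnj])
  have step: "partial_x g t y = - cnj (partial_x h t y)"
    if "smooth_family I h" and "\<And>y. g t y = - cnj (h t y)" for g h y
    using partial_x_cong[of g t "\<lambda>t y. - cnj (h t y)" y] that(2)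
      partial_x_linear[OF cl that(1) t, of y] by simp
  have vel1: "partial_x vel t y = - cnj (?S1 t y)" for y
    by (rule step[of ?S vel]) (simp_all add: sS vel[OF t])
  have vel2: "partial_x (partial_x vel) t y = - cnj (?S2 t y)" for y
    by (rule step[of ?S1 "partial_x vel"]) (simp_all add: sm vel1)
  have vel3: "partial_x (partial_x (partial_x vel)) t y = - cnj (?S3 t y)" for y
    by (rule step[of ?S2 "partial_x (partial_x vel)"]) (simp_all add: sm vel2)
  have ev: "partial_t I ?S t x = - cnj (?S t x) * ?S1 t x - 2 * cnj (?S1 t x) * ?S t x - cnj (?S3 t x)"
  proof -
    have "partial_t I ?S t x = vel t x * ?S1 t x + 2 * partial_x vel t x * ?S t x + partial_x (partial_x (partial_x vel)) t x"
      by (rule schwarzian_evolution[OF smooth_z _ smooth_vel _ t]) (simp_all add: z1_nonzero vel_def)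
    then show ?thesis
      by (simp add: vel[OF t] vel1 vel3)
  qed
  have "((\<lambda>s. - Re (?S s x)) has_real_derivative - Re (partial_t I ?S t x)) (at t within I)"
    by (intro DERIV_minus real_derivs(6)[OF t] sS)
  then have 1: "((\<lambda>s. k1 (u s) x) has_real_derivative - Re (partial_t I ?S t x)) (at t within I)"
    unfolding has_field_derivative_def by (rule has_derivative_transform[OF t, rotated]) (simp add: k1)
  have "((\<lambda>s. Im (?S s x)) has_real_derivative Im (partial_t I ?S t x)) (at t within I)"
    by (intro real_derivs(7)[OF t] sS)
  then have 2: "((\<lambda>s. k2 (u s) x) has_real_derivative Im (partial_t I ?S t x)) (at t within I)"
    unfolding has_field_derivative_def by (rule has_derivative_transform[OF t, rotated]) (simp add: k2)
  have d3: "(dx ^^ 3) g = dx (dx (dx g))" for g :: "real \<Rightarrow> real"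
    by (simp add: eval_nat_numeral)
  show "((\<lambda>s. k1 (u s) x) has_real_derivative
      - (dx ^^ 3) (k1 (u t)) x + 3 * k1 (u t) x * dx (k1 (u t)) x + 3 * k2 (u t) x * dx (k2 (u t)) x)
      (at t within I)"
    using 1 unfolding d3 k1[OF t] k2[OF t] dRe[OF sS] dIm[OF sS] dRe[OF smooth_partial_x[OF sS]]
      dRe[OF smooth_partial_x[OF smooth_partial_x[OF sS]]]
    by (rule DERIV_cong) (simp add: ev algebra_simps)
  show "((\<lambda>s. k2 (u s) x) has_real_derivative
      (dx ^^ 3) (k2 (u t)) x + dx (k1 (u t)) x * k2 (u t) x - k1 (u t) x * dx (k2 (u t)) x)
      (at t within I)"
    using 2 unfolding d3 k1[OF t] k2[OF t] dRe[OF sS] dIm[OF sS] dIm[OF smooth_partial_x[OF sS]]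
      dIm[OF smooth_partial_x[OF smooth_partial_x[OF sS]]]
    by (rule DERIV_cong) (simp add: ev algebra_simps)
qed

end

section \<open>The variational derivatives of the Hamiltonian\<close>

lemma smooth_periodic_continuous: "smooth_periodic L f \<Longrightarrow> continuous_on S f"
proof -
  assume "smooth_periodic L f"
  then have "((dx ^^ 0) f) differentiable (at x)" for x
    unfolding smooth_periodic_def by blast
  then show ?thesis
    by (simp add: continuous_at_imp_continuous_on differentiable_imp_continuous_within)
qed

text \<open>
Along \<open>f + \<epsilon> \<phi>\<close> the functional is a quadratic polynomial in \<open>\<epsilon>\<close>, with linear coefficient \<open>\<integral> f \<phi>\<close>.
The function \<open>c\<close> stands for the square of the other invariant, which is kept fixed.
\<close>

lemma has_variational_derivative_square:
  assumes f: "smooth_periodic L f" and c: "continuous_on {0..L} c"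
  shows "has_variational_derivative L (\<lambda>g. 1 / 2 * integral {0..L} (\<lambda>x. (g x)\<^sup>2 + c x)) f f"
  unfolding has_variational_derivative_def
proof (intro conjI allI impI f)
  fix \<phi> assume \<phi>: "smooth_periodic L \<phi>"
  note cont = smooth_periodic_continuous[OF f, of "{0..L}"] smooth_periodic_continuous[OF \<phi>, of "{0..L}"] c
  note int = integrable_continuous_real
  have "1 / 2 * integral {0..L} (\<lambda>x. (f x + \<epsilon> * \<phi> x)\<^sup>2 + c x)
      = 1 / 2 * integral {0..L} (\<lambda>x. (f x)\<^sup>2 + c x) + \<epsilon> * integral {0..L} (\<lambda>x. f x * \<phi> x)
        + \<epsilon>\<^sup>2 * (1 / 2 * integral {0..L} (\<lambda>x. (\<phi> x)\<^sup>2))" for \<epsilon>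
  proof -
    have "integral {0..L} (\<lambda>x. (f x + \<epsilon> * \<phi> x)\<^sup>2 + c x)
      = integral {0..L} (\<lambda>x. ((f x)\<^sup>2 + c x) + ((2 * \<epsilon>) * (f x * \<phi> x) + \<epsilon>\<^sup>2 * (\<phi> x)\<^sup>2))"
      by (intro arg_cong[where f="integral {0..L}"] ext) (simp add: algebra_simps power2_eq_square)
    also have "\<dots> = integral {0..L} (\<lambda>x. (f x)\<^sup>2 + c x)
      + integral {0..L} (\<lambda>x. (2 * \<epsilon>) * (f x * \<phi> x) + \<epsilon>\<^sup>2 * (\<phi> x)\<^sup>2)"
      by (intro Henstock_Kurzweil_Integration.integral_add int continuous_intros cont)
    also have "integral {0..L} (\<lambda>x. (2 * \<epsilon>) * (f x * \<phi> x) + \<epsilon>\<^sup>2 * (\<phi> x)\<^sup>2)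
      = integral {0..L} (\<lambda>x. (2 * \<epsilon>) * (f x * \<phi> x)) + integral {0..L} (\<lambda>x. \<epsilon>\<^sup>2 * (\<phi> x)\<^sup>2)"
      by (intro Henstock_Kurzweil_Integration.integral_add int continuous_intros cont)
    also have "integral {0..L} (\<lambda>x. (2 * \<epsilon>) * (f x * \<phi> x)) = 2 * \<epsilon> * integral {0..L} (\<lambda>x. f x * \<phi> x)"
      by (rule integral_mult_right)
    also have "integral {0..L} (\<lambda>x. \<epsilon>\<^sup>2 * (\<phi> x)\<^sup>2) = \<epsilon>\<^sup>2 * integral {0..L} (\<lambda>x. (\<phi> x)\<^sup>2)"
      by (rule integral_mult_right)
    finally show ?thesis by simp
  qed
  then show "((\<lambda>\<epsilon>. 1 / 2 * integral {0..L} (\<lambda>x. (f x + \<epsilon> * \<phi> x)\<^sup>2 + c x)) has_real_derivative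
      integral {0..L} (\<lambda>x. f x * \<phi> x)) (at 0)"
    by (auto intro!: derivative_eq_intros)
qed

lemma hamiltonian_variational_derivatives:
  assumes "smooth_periodic L \<kappa>1" and "smooth_periodic L \<kappa>2"
  shows "has_variational_derivative L (\<lambda>f. hamiltonian L f \<kappa>2) \<kappa>1 \<kappa>1"
    and "has_variational_derivative L (\<lambda>f. hamiltonian L \<kappa>1 f) \<kappa>2 \<kappa>2"
  using has_variational_derivative_square[OF assms(1), of "\<lambda>x. (\<kappa>2 x)\<^sup>2"]
    has_variational_derivative_square[OF assms(2), of "\<lambda>x. (\<kappa>1 x)\<^sup>2"]
    smooth_periodic_continuous[OF assms(1)] smooth_periodic_continuous[OF assms(2)]
  by (auto simp: hamiltonian_def add.commute intro: continuous_on_power)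

section \<open>The flow induced by the Hamiltonian\<close>

theorem theorem6p1:
  fixes u :: "real \<Rightarrow> real \<Rightarrow> real^4" and I :: "real set" and t0 L :: real
  assumes "is_interval I" and "interior I \<noteq> {}" and "t0 \<in> I" and "L > 0"
    and "smooth_family I u"
    and "\<forall>t\<in>I. \<forall>x. u t x \<in> upper_light_cone"
    and "\<forall>t\<in>I. star_shaped (u t)"
    and "\<forall>t\<in>I. has_monodromy L (u t)"
    and flow: "\<forall>t\<in>I. \<forall>x.
      ((\<lambda>s. loc (u s x)) has_vector_derivative
        (flow_matrix (u t) x *v vector [k1 (u t) x, k2 (u t) x, - dx (k1 (u t)) x]))
      (at t within I)"
  shows "(\<forall>\<kappa>1 \<kappa>2. smooth_periodic L \<kappa>1 \<longrightarrow> smooth_periodic L \<kappa>2 \<longrightarrow>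
           has_variational_derivative L (\<lambda>f. hamiltonian L f \<kappa>2) \<kappa>1 \<kappa>1 \<and>
           has_variational_derivative L (\<lambda>f. hamiltonian L \<kappa>1 f) \<kappa>2 \<kappa>2) \<and>
         (arc_length_parametrized (u t0) \<longrightarrow> (\<forall>t\<in>I. arc_length_parametrized (u t))) \<and>
         (arc_length_parametrized (u t0) \<longrightarrow> (\<forall>t\<in>I. \<forall>x.
           ((\<lambda>s. k1 (u s) x) has_real_derivative
              (- (dx ^^ 3) (k1 (u t)) x + 3 * k1 (u t) x * dx (k1 (u t)) x
                 + 3 * k2 (u t) x * dx (k2 (u t)) x)) (at t within I) \<and>
           ((\<lambda>s. k2 (u s) x) has_real_derivative
              ((dx ^^ 3) (k2 (u t)) x + dx (k1 (u t)) x * k2 (u t) x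
                 - k1 (u t) x * dx (k2 (u t)) x)) (at t within I)))"
proof -
  interpret cone_flow I u
    using assms by unfold_locales auto
  have unit: "k0 t x = 1" if "arc_length_parametrized (u t0)" "t \<in> I" for t x
    using arc_length_preserved[OF \<open>t0 \<in> I\<close> that] .
  show ?thesis
  proof (intro conjI impI allI ballI)
    show "arc_length_parametrized (u t)" if "arc_length_parametrized (u t0)" "t \<in> I" for t
      using unit[OF that] by (simp add: arc_length_parametrized_def k0_def)
  qed (intro hamiltonian_variational_derivatives curvature_evolution unit; assumption)+
qed
end
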